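(* Let $s\in(0,1)$ and $$C_s:=\frac{2^{2s+1}}{2^{2s}-1}>1.$$ Let $x_1^0<x_2^0<x_3^0$, $N=3$, $\zeta_1=\zeta_3=+1$, $\zeta_2=-1$, and assume $\sigma\equiv0$. Let $(x_1(t),x_2(t),x_3(t))$ and the collision time $T_c$ be those of the particle system described in the context. Let $\theta_1^0:=x_2^0-x_1^0$ and $\theta_2^0:=x_3^0-x_2^0$. Then $$T_c\in[\tau_c,\ C_s\tau_c],\qquad\text{with}\qquad \tau_c:=\frac{s\,\min\{\theta_1^0,\theta_2^0\}^{2s+1}}{(2s+1)\gamma}.$$ Moreover, the functions $\theta_1(t):=x_2(t)-x_1(t)$ and $\theta_2(t):=x_3(t)-x_2(t)$ are order preserving in time, i.e. if $\theta_1^0<\theta_2^0$ then $\theta_1(t)<\theta_2(t)$ for every $t\in[0,T_c]$. Furthermore, if $\theta_1^0=\theta_2^0$, then a triple collision occurs, namely $\theta_1(t)=\theta_2(t)>0$ for every $t\in[0,T_c)$, and $$\theta_1(T_c)=\theta_2(T_c)=0\qquad\text{with}\qquad T_c=\frac{C_s\,s\,(\theta_1^0)^{2s+1}}{(2s+1)\gamma}.$$ Conversely, if a triple collision occurs at time $T_c$ (that is, $\theta_1(T_c)=\theta_2(T_c)=0$), then $\theta_1^0=\theta_2^0$ and $T_c=\frac{C_s\,s\,(\theta_1^0)^{2s+1}}{(2s+1)\gamma}$.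
   Context: Operator: for $s\in(0,1)$ and $\varphi\in C^2(\mathbb R)\cap L^\infty(\mathbb R)$, $\mathcal I_s[\varphi](x):=PV\int_{\mathbb R}\frac{\varphi(x+y)-\varphi(x)}{|y|^{1+2s}}\,dy$. $W$ satisfies: $W\in C^{3,\alpha}(\mathbb R)$ for some $0<\alpha<1$; $W(v+1)=W(v)$ for all $v\in\mathbb R$; $W=0$ on $\mathbb Z$; $W>0$ on $\mathbb R\setminus\mathbb Z$; $W''(0)>0$. Layer solution: $u$ is the unique solution of $\mathcal I_s(u)=W'(u)$ in $\mathbb R$, $u'>0$ in $\mathbb R$, $\lim_{x\to-\infty}u(x)=0$, $\lim_{x\to+\infty}u(x)=1$, $u(0)=\tfrac12$ (its existence and uniqueness are known). Set $\gamma:=\left(\int_{\mathbb R}(u'(x))^2dx\right)^{-1}>0$. Particle system (with $\sigma\equiv0$): $(x_i(t))_{i=1,\dots,N}$ solves $$\dot x_i=\gamma\sum_{j\ne i}\zeta_i\zeta_j\frac{x_i-x_j}{2s|x_i-x_j|^{1+2s}}\ \text{ in }(0,T_c),\qquad x_i(0)=x_i^0,$$ where $(0,T_c)$, $0<T_c\le+\infty$, is the maximal interval on which the system is well defined, i.e. on which $x_i\ne x_j$ for all $i\ne j$; thus $T_c$ is the first collision time ($+\infty$ if there is no collision). Values at $t=T_c$ are understood as limits for $t\to T_c^-$. *)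

theory Defs
  imports "HOL-Analysis.Analysis"
begin

definition Ck :: "nat \<Rightarrow> (real \<Rightarrow> real) \<Rightarrow> bool" where
  "Ck k f \<longleftrightarrow> (\<forall>j<k. \<forall>x. (deriv ^^ j) f differentiable (at x)) \<and>
     continuous_on UNIV ((deriv ^^ k) f)"

(* Only the Hoelder seminorm of the k-th derivative is required to be finite. For a periodic
   f, the only case used here, the derivatives up to order k are then automatically bounded. *)
definition Ck_Holder :: "nat \<Rightarrow> real \<Rightarrow> (real \<Rightarrow> real) \<Rightarrow> bool" where
  "Ck_Holder k \<alpha> f \<longleftrightarrow> Ck k f \<and>
     (\<exists>C. \<forall>x y. \<bar>(deriv ^^ k) f x - (deriv ^^ k) f y\<bar> \<le> C * \<bar>x - y\<bar> powr \<alpha>)"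

definition multiwell_potential :: "(real \<Rightarrow> real) \<Rightarrow> bool" where
  "multiwell_potential W \<longleftrightarrow>
     (\<exists>\<alpha>. 0 < \<alpha> \<and> \<alpha> < 1 \<and> Ck_Holder 3 \<alpha> W) \<and>
     (\<forall>v. W (v + 1) = W v) \<and>
     (\<forall>v\<in>\<int>. W v = 0) \<and>
     (\<forall>v. v \<notin> \<int> \<longrightarrow> 0 < W v) \<and>
     0 < (deriv ^^ 2) W 0"

(* Principal value at the origin: the limit of the integrals over |y| > e as e decreases to 0.
   Integrability away from the origin is demanded explicitly, because the Lebesgue integral
   of a non-integrable function is 0 by convention. *)
definition has_PV_integral :: "(real \<Rightarrow> real) \<Rightarrow> real \<Rightarrow> bool" where
  "has_PV_integral f I \<longleftrightarrow>
     (\<forall>e>0. set_integrable lborel {y. e < \<bar>y\<bar>} f) \<and>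
     ((\<lambda>e. LINT y:{y. e < \<bar>y\<bar>}|lborel. f y) \<longlongrightarrow> I) (at_right 0)"

(* "The value of the operator I_s on \<phi> at x exists and equals L." *)
definition has_frac_op :: "real \<Rightarrow> (real \<Rightarrow> real) \<Rightarrow> real \<Rightarrow> real \<Rightarrow> bool" where
  "has_frac_op s \<phi> x L \<longleftrightarrow>
     has_PV_integral (\<lambda>y. (\<phi> (x + y) - \<phi> x) / \<bar>y\<bar> powr (1 + 2 * s)) L"

(* C^2 and bounded is the domain on which the operator I_s is considered. *)
definition layer_solution :: "real \<Rightarrow> (real \<Rightarrow> real) \<Rightarrow> (real \<Rightarrow> real) \<Rightarrow> bool" where
  "layer_solution s W u \<longleftrightarrow>
     Ck 2 u \<and> bounded (range u) \<and>
     (\<forall>x. has_frac_op s u x (deriv W (u x))) \<and>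
     (\<forall>x. 0 < deriv u x) \<and>
     (u \<longlongrightarrow> 0) at_bot \<and> (u \<longlongrightarrow> 1) at_top \<and> u 0 = 1 / 2"

definition layer_gamma :: "(real \<Rightarrow> real) \<Rightarrow> real" where
  "layer_gamma u = inverse (LINT x|lborel. (deriv u x)\<^sup>2)"

(* Velocity of particle i in the configuration p; the particles are indexed by 1, ..., N. *)
definition particle_velocity ::
  "real \<Rightarrow> real \<Rightarrow> nat \<Rightarrow> (nat \<Rightarrow> real) \<Rightarrow> (nat \<Rightarrow> real) \<Rightarrow> nat \<Rightarrow> real" where
  "particle_velocity \<gamma> s N \<zeta> p i =
     \<gamma> * (\<Sum>j\<in>{1..N} - {i}. \<zeta> i * \<zeta> j * ((p i - p j) / (2 * s * \<bar>p i - p j\<bar> powr (1 + 2 * s))))"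

(* Collision-free solution on (0,T), with T possibly infinite, attaining the initial data
   continuously; x i t is the position of particle i at time t. *)
definition particle_solution ::
  "real \<Rightarrow> real \<Rightarrow> nat \<Rightarrow> (nat \<Rightarrow> real) \<Rightarrow> (nat \<Rightarrow> real) \<Rightarrow> (nat \<Rightarrow> real \<Rightarrow> real) \<Rightarrow> ereal \<Rightarrow> bool" where
  "particle_solution \<gamma> s N \<zeta> x0 x T \<longleftrightarrow>
     0 < T \<and>
     (\<forall>i\<in>{1..N}. x i 0 = x0 i \<and> continuous (at_right 0) (x i)) \<and>
     (\<forall>t. 0 < t \<and> ereal t < T \<longrightarrow>
        (\<forall>i\<in>{1..N}. \<forall>j\<in>{1..N}. i \<noteq> j \<longrightarrow> x i t \<noteq> x j t) \<and>
        (\<forall>i\<in>{1..N}.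
           (x i has_real_derivative particle_velocity \<gamma> s N \<zeta> (\<lambda>j. x j t) i) (at t)))"

(* (0,T) is the maximal interval of existence: x has no collision-free continuation. *)
definition maximal_particle_solution ::
  "real \<Rightarrow> real \<Rightarrow> nat \<Rightarrow> (nat \<Rightarrow> real) \<Rightarrow> (nat \<Rightarrow> real) \<Rightarrow> (nat \<Rightarrow> real \<Rightarrow> real) \<Rightarrow> ereal \<Rightarrow> bool" where
  "maximal_particle_solution \<gamma> s N \<zeta> x0 x T \<longleftrightarrow>
     particle_solution \<gamma> s N \<zeta> x0 x T \<and>
     \<not> (\<exists>y T'. T < T' \<and> particle_solution \<gamma> s N \<zeta> x0 y T' \<and>
          (\<forall>i\<in>{1..N}. \<forall>t. 0 \<le> t \<and> ereal t < T \<longrightarrow> y i t = x i t))"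

definition collision_const :: "real \<Rightarrow> real" where
  "collision_const s = 2 powr (2 * s + 1) / (2 powr (2 * s) - 1)"

end

theory Submission
  imports Defs
begin

text \<open>Positivity of \<open>\<gamma>\<close> amounts to \<open>u' \<in> L\<^sup>2\<close>. If \<open>M\<close> is the maximum of \<open>u (x + h) - u x\<close>, then
  subtracting the equation for \<open>u\<close> at the two corresponding points, with \<open>W'\<close> Lipschitz and
  \<open>u (\<cdot> + h) - u\<close> of integral at most \<open>h\<close> over any interval, gives \<open>M \<le> K h\<close> with \<open>K\<close> independent
  of \<open>h\<close>. Hence \<open>0 < u' \<le> K\<close>, and \<open>u'\<close> is integrable because \<open>u\<close> is bounded.

  With \<open>c = \<gamma> / (2 s)\<close> and \<open>p = 2 s\<close> the gaps satisfy
  \<open>a' = c (b\<^sup>-\<^sup>p + (a + b)\<^sup>-\<^sup>p - 2 a\<^sup>-\<^sup>p)\<close> and the same equation with \<open>a\<close> and \<open>b\<close> exchanged. Then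
  \<open>((b - a)\<^sup>2)' = 6 c (b - a) (a\<^sup>-\<^sup>p - b\<^sup>-\<^sup>p) \<ge> 0\<close>, so the order of the gaps persists and a triple
  collision forces equal gaps. If \<open>a \<le> b\<close>, then \<open>-2 c a\<^sup>-\<^sup>p \<le> a' \<le> -c (1 - 2\<^sup>-\<^sup>p) a\<^sup>-\<^sup>p\<close>; integrating
  \<open>(a\<^sup>p\<^sup>+\<^sup>1)'\<close> gives both bounds on the time at which \<open>a\<close> vanishes, with equality in the upper one
  when \<open>a = b\<close>. If both gaps had positive limits at \<open>T\<^sub>c\<close>, Picard iteration would continue the
  solution, contradicting maximality.\<close>

section \<open>The gradient of the layer solution\<close>

text \<open>A quantitative maximum principle: at a maximum point of \<open>u (x + h) - u x\<close> the integrand of the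
  difference of the two principal values is nonpositive, so that difference is bounded above by the
  contribution of \<open>[r/2, r]\<close> alone, on which the increment has integral at most \<open>h\<close>.\<close>

lemma has_frac_op_difference_le:
  fixes u :: "real \<Rightarrow> real"
  assumes cont: "continuous_on UNIV u" and u01: "\<And>x. 0 \<le> u x" "\<And>x. u x \<le> 1"
    and s: "0 < s" and r: "0 < r" and h: "0 < h"
    and max: "\<And>x. u (x + h) - u x \<le> M" and M: "M = u (x0 + h) - u x0"
    and L1: "has_frac_op s u (x0 + h) L1" and L0: "has_frac_op s u x0 L0"
  shows "L1 - L0 \<le> (h - r / 2 * M) / r powr (1 + 2 * s)"
proof -
  define f1 where "f1 = (\<lambda>y. (u (x0 + h + y) - u (x0 + h)) / \<bar>y\<bar> powr (1 + 2 * s))"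
  define f0 where "f0 = (\<lambda>y. (u (x0 + y) - u x0) / \<bar>y\<bar> powr (1 + 2 * s))"
  define g where "g = (\<lambda>y. u (x0 + h + y) - u (x0 + y) - M)"
  define k where "k = (\<lambda>y. g y / r powr (1 + 2 * s))"
  have g_le: "g y \<le> 0" for y
    using max[of "x0 + y"] by (simp add: g_def algebra_simps)
  \<comment> \<open>By the choice of \<open>x0\<close>, subtracting the two integrands leaves the
    increment at \<open>x0 + y\<close> minus its maximal value \<open>M\<close>, so the sign is
    known for every \<open>y\<close>.\<close>
  have f_diff: "f1 y - f0 y = g y / \<bar>y\<bar> powr (1 + 2 * s)" for y
    unfolding f1_def f0_def g_def M by (simp add: diff_divide_distrib)
  have cu: "isCont u x" for x
    using cont by (simp add: continuous_on_eq_continuous_at)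
  have ck: "continuous_on A k" for A
    unfolding k_def g_def using r
    by (intro continuous_intros continuous_on_subset[OF cont] continuous_on_compose2[OF cont]) auto
  \<comment> \<open>An antiderivative turns the integral of the increment over
    \<open>{r/2..r}\<close> into differences \<open>U (x + h) - U x\<close>, which lie between 0 and
    \<open>h\<close> because \<open>u\<close> has values in \<open>[0,1]\<close>.\<close>
  obtain U where U: "\<And>x. (U has_vector_derivative u x) (at x)"
    using einterval_antiderivative[of "-\<infinity>" \<infinity> u] cu by auto
  then have U': "(U has_real_derivative u x) (at x)" for x
    by (simp add: has_real_derivative_iff_has_vector_derivative)
  have U_shift: "((\<lambda>y. U (c + y)) has_real_derivative u (c + y)) (at y within A)" for c y A
  proof -
    have "((\<lambda>y. U (y + c)) has_real_derivative u (y + c)) (at y)"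
      using U'[of "y + c"] unfolding DERIV_shift .
    then show ?thesis
      unfolding add.commute[of _ c] by (rule has_field_derivative_at_within)
  qed
  define K where "K = (\<lambda>y. (U (x0 + h + y) - U (x0 + y) - M * y) / r powr (1 + 2 * s))"
  have dK: "(K has_vector_derivative k y) (at y within A)" for y A
    unfolding has_real_derivative_iff_has_vector_derivative[symmetric] K_def k_def g_def
    using DERIV_cdivide[OF DERIV_diff[OF DERIV_diff[OF U_shift[of "x0 + h" y A] U_shift[of x0 y A]]
          DERIV_cmult[OF DERIV_ident, of M]], of "r powr (1 + 2 * s)"]
    by simp
  have intK: "(LINT y:{r/2..r}|lborel. k y) = K r - K (r / 2)"
    unfolding set_lebesgue_integral_def
    by (rule integral_FTC_atLeastAtMost) (use r dK ck in auto)
  have U_incr: "0 \<le> U (x + h) - U x \<and> U (x + h) - U x \<le> h" for x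
  proof -
    obtain z where "U (x + h) - U x = (x + h - x) * u z"
      using MVT2[of x "x + h" U u] U' h by auto
    then have "U (x + h) - U x = h * u z" by simp
    then show ?thesis using u01[of z] h by (simp add: mult_left_le)
  qed
  have "K r - K (r/2) = ((U (x0 + r + h) - U (x0 + r)) - (U (x0 + r/2 + h) - U (x0 + r/2))
      - r / 2 * M) / r powr (1 + 2 * s)"
    unfolding K_def diff_divide_distrib[symmetric]
    by (rule arg_cong2[where f = "(/)"]) (simp_all add: add_ac mult.commute)
  also have "\<dots> \<le> (h - r / 2 * M) / r powr (1 + 2 * s)"
    using U_incr[of "x0 + r"] U_incr[of "x0 + r/2"] by (intro divide_right_mono) auto
  finally have K_le: "K r - K (r/2) \<le> (h - r / 2 * M) / r powr (1 + 2 * s)" .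
  have int1: "set_integrable lborel {y. e < \<bar>y\<bar>} f1" if "e > 0" for e
    using L1 that by (simp add: has_frac_op_def has_PV_integral_def f1_def)
  have int0: "set_integrable lborel {y. e < \<bar>y\<bar>} f0" if "e > 0" for e
    using L0 that by (simp add: has_frac_op_def has_PV_integral_def f0_def)
  have lim: "((\<lambda>e. (LINT y:{y. e < \<bar>y\<bar>}|lborel. f1 y) - (LINT y:{y. e < \<bar>y\<bar>}|lborel. f0 y))
      \<longlongrightarrow> L1 - L0) (at_right 0)"
    using L1 L0 by (intro tendsto_diff) (simp_all add: has_frac_op_def has_PV_integral_def f1_def f0_def)
  have ev: "\<forall>\<^sub>F e in at_right 0. (LINT y:{y. e < \<bar>y\<bar>}|lborel. f1 y) - (LINT y:{y. e < \<bar>y\<bar>}|lborel. f0 y)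
      \<le> (h - r / 2 * M) / r powr (1 + 2 * s)"
    using eventually_at_right_real[OF half_gt_zero[OF r]]
  proof eventually_elim
    case (elim e)
    then have e: "0 < e" "e < r/2" by auto
    have "(LINT y:{y. e < \<bar>y\<bar>}|lborel. f1 y) - (LINT y:{y. e < \<bar>y\<bar>}|lborel. f0 y)
        = (LINT y:{y. e < \<bar>y\<bar>}|lborel. f1 y - f0 y)"
      using int1[OF e(1)] int0[OF e(1)] by simp
    also have "\<dots> \<le> (LINT y:{r/2..r}|lborel. k y)"
      unfolding set_lebesgue_integral_def
    proof (rule integral_mono)
      show "integrable lborel (\<lambda>y. indicat_real {y. e < \<bar>y\<bar>} y *\<^sub>R (f1 y - f0 y))"
        using set_integral_diff(1)[OF int1[OF e(1)] int0[OF e(1)]] by (simp add: set_integrable_def)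
      show "integrable lborel (\<lambda>y. indicat_real {r/2..r} y *\<^sub>R k y)"
        using borel_integrable_atLeastAtMost'[OF ck] by (simp add: set_integrable_def)
      fix y
      \<comment> \<open>Outside \<open>{r/2..r}\<close> a nonpositive integrand is dropped; inside,
        the nonpositive \<open>g y\<close> is divided by the larger
        \<open>r powr (1 + 2 * s)\<close>. Both changes can only increase the integral, and
        \<open>e < r/2\<close> keeps \<open>{r/2..r}\<close> inside the truncated domain.\<close>
      have "g y / y powr (1 + 2 * s) \<le> g y / r powr (1 + 2 * s)" if "r/2 \<le> y" "y \<le> r"
      proof -
        have "y powr (1 + 2 * s) \<le> r powr (1 + 2 * s)" using that r s by (intro powr_mono2) auto
        then show ?thesis using g_le that r by (intro divide_left_mono_neg) auto
      qed
      then show "indicat_real {y. e < \<bar>y\<bar>} y *\<^sub>R (f1 y - f0 y) \<le> indicat_real {r/2..r} y *\<^sub>R k y"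
        using g_le[of y] e r by (auto simp: f_diff k_def indicator_def divide_nonpos_nonneg)
    qed
    also have "\<dots> \<le> (h - r / 2 * M) / r powr (1 + 2 * s)"
      using intK K_le by simp
    finally show ?case .
  qed
  show ?thesis
    by (rule tendsto_upperbound[OF lim ev]) simp
qed

text \<open>By the two limits, \<open>g\<close> lies below the positive value \<open>g a\<close>
  outside a compact interval, so the maximum over that interval is global.\<close>

lemma continuous_vanishing_attains_max:
  fixes g :: "real \<Rightarrow> real"
  assumes cont: "continuous_on UNIV g" and pos: "0 < g a"
    and bot: "(g \<longlongrightarrow> 0) at_bot" and top: "(g \<longlongrightarrow> 0) at_top"
  obtains z where "\<And>x. g x \<le> g z"
proof -
  have "\<forall>\<^sub>F x in at_bot. g x < g a" using bot pos by (rule order_tendstoD)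
  then obtain l where l: "\<And>x. x \<le> l \<Longrightarrow> g x < g a" unfolding eventually_at_bot_linorder by blast
  have "\<forall>\<^sub>F x in at_top. g x < g a" using top pos by (rule order_tendstoD)
  then obtain m where m: "\<And>x. x \<ge> m \<Longrightarrow> g x < g a" unfolding eventually_at_top_linorder by blast
  have am: "a \<in> {l..m}" using l[of a] m[of a] by (cases "a \<le> l"; cases "m \<le> a") auto
  have "\<exists>z\<in>{l..m}. \<forall>x\<in>{l..m}. g x \<le> g z"
    using am by (intro continuous_attains_sup continuous_on_subset[OF cont]) auto
  then obtain z where z: "\<And>x. x \<in> {l..m} \<Longrightarrow> g x \<le> g z" by blast
  have "g x \<le> g z" for x
  proof (cases "x \<in> {l..m}")
    case False
    then have "g x < g a" using l m by force
    then show ?thesis using z[OF am] by linarith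
  qed (use z in auto)
  then show ?thesis using that by blast
qed

text \<open>The second derivative of \<open>W\<close> is continuous, hence bounded on
  \<open>[0,1]\<close>, and the mean value theorem applies. That interval suffices because it
  contains the range of \<open>u\<close>.\<close>

lemma multiwell_potential_deriv_lipschitz:
  assumes "multiwell_potential W"
  obtains C where "0 < C"
    "\<And>v w. \<lbrakk>0 \<le> v; v \<le> w; w \<le> 1\<rbrakk> \<Longrightarrow> \<bar>deriv W w - deriv W v\<bar> \<le> C * (w - v)"
proof -
  have "Ck 3 W" using assms by (auto simp: multiwell_potential_def Ck_Holder_def)
  then have diff: "\<And>j x. j < 3 \<Longrightarrow> (deriv ^^ j) W differentiable (at x)" by (auto simp: Ck_def)
  have d1: "(deriv W has_real_derivative deriv (deriv W) x) (at x)" for x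
    using diff[of 1 x] by (simp add: real_differentiable_def DERIV_imp_deriv) (metis DERIV_imp_deriv)
  have "continuous_on {0..1} (deriv (deriv W))"
  proof (rule continuous_at_imp_continuous_on, rule ballI)
    fix x :: real
    show "isCont (deriv (deriv W)) x"
      using diff[of 2 x] by (auto simp: numeral_2_eq_2 intro: differentiable_imp_continuous_within)
  qed
  then have "bounded (deriv (deriv W) ` {0..1})"
    by (intro compact_imp_bounded compact_continuous_image) auto
  then obtain B where B: "0 < B" "\<And>x. \<lbrakk>0 \<le> x; x \<le> 1\<rbrakk> \<Longrightarrow> \<bar>deriv (deriv W) x\<bar> \<le> B"
    unfolding bounded_pos by (metis atLeastAtMost_iff imageI real_norm_def)
  have "\<bar>deriv W w - deriv W v\<bar> \<le> B * (w - v)" if vw: "0 \<le> v" "v \<le> w" "w \<le> 1" for v w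
  proof (cases "v = w")
    case False
    then obtain z where z: "v < z" "z < w" "deriv W w - deriv W v = (w - v) * deriv (deriv W) z"
      using MVT2[of v w "deriv W" "deriv (deriv W)"] d1 vw by auto
    show ?thesis using B(2)[of z] z vw False
      by (simp add: abs_mult mult.commute mult_right_mono)
  qed simp
  then show ?thesis using that B(1) by blast
qed

section \<open>Lipschitz bound and square integrability for the layer solution\<close>

context
  fixes s :: real and W u :: "real \<Rightarrow> real"
  assumes s: "0 < s" and W: "multiwell_potential W" and u: "layer_solution s W u"
begin

lemma layer_has_derivative: "(u has_real_derivative deriv u x) (at x)"
proof -
  have "(deriv ^^ 0) u differentiable (at x)" using u unfolding layer_solution_def Ck_def by (metis zero_less_numeral)
  then show ?thesis by (simp add: real_differentiable_def) (metis DERIV_imp_deriv)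
qed

lemma layer_deriv_isCont: "isCont (deriv u) x"
proof -
  have "(deriv ^^ 1) u differentiable (at x)"
    using u unfolding layer_solution_def Ck_def by (meson one_less_numeral_iff semiring_norm(76))
  then show ?thesis by (auto intro: differentiable_imp_continuous_within)
qed

lemma layer_continuous: "continuous_on UNIV u"
  using layer_has_derivative by (meson DERIV_isCont continuous_at_imp_continuous_on)

lemma layer_deriv_pos: "0 < deriv u x"
  using u by (simp add: layer_solution_def)

lemma layer_strict_mono: "x < y \<Longrightarrow> u x < u y"
  using DERIV_pos_imp_increasing[of x y u] layer_has_derivative layer_deriv_pos by blast

lemma layer_tendsto: "(u \<longlongrightarrow> 0) at_bot" "(u \<longlongrightarrow> 1) at_top"
  using u by (simp_all add: layer_solution_def)

lemma layer_nonneg: "0 \<le> u x"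
proof (rule tendsto_upperbound[OF layer_tendsto(1)])
  show "\<forall>\<^sub>F y in at_bot. u y \<le> u x"
    unfolding eventually_at_bot_linorder using layer_strict_mono by (metis order_le_less)
qed simp

lemma layer_le_1: "u x \<le> 1"
proof (rule tendsto_lowerbound[OF layer_tendsto(2)])
  show "\<forall>\<^sub>F y in at_top. u x \<le> u y"
    unfolding eventually_at_top_linorder using layer_strict_mono by (metis order_le_less)
qed simp

text \<open>At a maximum point \<open>z\<close> of the increment the equation for \<open>u\<close>
  replaces the operator values by values of \<open>deriv W\<close>, whose difference is at least
  \<open>- (C * g z)\<close>. The maximum principle bounds the same difference from above, and
  comparing the two bounds controls \<open>g z\<close>.\<close>

lemma layer_increment_bound:
  obtains K where "0 < K" "\<And>x h. 0 < h \<Longrightarrow> u (x + h) - u x \<le> K * h"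
proof -
  obtain C where C: "0 < C"
    "\<And>v w. \<lbrakk>0 \<le> v; v \<le> w; w \<le> 1\<rbrakk> \<Longrightarrow> \<bar>deriv W w - deriv W v\<bar> \<le> C * (w - v)"
    using multiwell_potential_deriv_lipschitz[OF W] by blast
  \<comment> \<open>This radius gives \<open>r powr (2 * s) = inverse (4 * C)\<close>. For a maximal
    increment \<open>M\<close>, the negative term of the maximum principle is then
    \<open>- 2 * C * M\<close>, twice the Lipschitz error \<open>C * M\<close>.\<close>
  define r where "r = (4 * C) powr (- 1 / (2 * s))"
  have r: "0 < r" using C by (simp add: r_def)
  have "- 1 / (2 * s) * (2 * s) = - 1" using s by simp
  then have "r powr (2 * s) = (4 * C) powr (- 1)"
    unfolding r_def powr_powr by (rule arg_cong)
  also have "\<dots> = inverse (4 * C)"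
    using C(1) by (simp only: powr_neg_one divide_inverse)
  finally have r2s: "r powr (2 * s) = inverse (4 * C)" .
  have rq: "r powr (1 + 2 * s) = r / (4 * C)"
    using r unfolding powr_add r2s by (simp add: field_simps)
  have "u (x + h) - u x \<le> (4 / r) * h" if h: "0 < h" for x h
  proof -
    define g where "g = (\<lambda>x. u (x + h) - u x)"
    have cg: "continuous_on UNIV g"
      unfolding g_def by (intro continuous_intros layer_continuous continuous_on_compose2[OF layer_continuous]) auto
    have shift: "filterlim (\<lambda>x. x + h) at_bot at_bot" "filterlim (\<lambda>x. x + h) at_top at_top"
      using filterlim_tendsto_add_at_bot_iff[OF tendsto_const, of h "\<lambda>x. x" at_bot]
        filterlim_tendsto_add_at_top[OF tendsto_const filterlim_ident, of h]
      unfolding add.commute[of h] by (blast intro: filterlim_ident)+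
    have "(g \<longlongrightarrow> 0 - 0) at_bot" "(g \<longlongrightarrow> 1 - 1) at_top"
      unfolding g_def
      by (intro tendsto_diff layer_tendsto filterlim_compose[OF layer_tendsto(1) shift(1)]
          filterlim_compose[OF layer_tendsto(2) shift(2)])+
    then obtain z where z: "\<And>x. g x \<le> g z"
      using continuous_vanishing_attains_max[OF cg, of x] layer_strict_mono[of x "x + h"] h
      by (auto simp: g_def)
    have "deriv W (u (z + h)) - deriv W (u z) \<le> (h - r / 2 * g z) / r powr (1 + 2 * s)"
      using u z h by (intro has_frac_op_difference_le[of u s r h "g z" z])
        (auto simp: layer_continuous layer_nonneg layer_le_1 s r g_def layer_solution_def)
    moreover have "\<bar>deriv W (u (z + h)) - deriv W (u z)\<bar> \<le> C * g z"
      unfolding g_def using layer_strict_mono[of z "z + h"] h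
      by (intro C(2)) (auto simp: layer_nonneg layer_le_1)
    ultimately have "- (C * g z) \<le> (h - r / 2 * g z) * (4 * C) / r"
      unfolding rq by simp
    then have "- (C * g z) * r \<le> (h - r / 2 * g z) * (4 * C)"
      using r by (simp add: pos_le_divide_eq)
    then have "C * (r * g z) \<le> C * (4 * h)" by (simp add: algebra_simps)
    then have "r * g z \<le> 4 * h" using C(1) by simp
    then have "g z \<le> (4 / r) * h" using r by (simp add: field_simps)
    then show ?thesis using z[of x] by (simp add: g_def)
  qed
  then show ?thesis using that[of "4 / r"] r by simp
qed

text \<open>The square is dominated by \<open>K * deriv u x\<close>, and \<open>deriv u\<close> is
  integrable by the fundamental theorem of calculus, as \<open>u\<close> increases from 0 to
  1.\<close>

lemma layer_deriv_square_integrable: "integrable lborel (\<lambda>x. (deriv u x)\<^sup>2)"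
proof -
  obtain K where K: "0 < K" "\<And>x h. 0 < h \<Longrightarrow> u (x + h) - u x \<le> K * h"
    using layer_increment_bound by blast
  have bound: "deriv u x \<le> K" for x
  proof (rule tendsto_upperbound)
    show "((\<lambda>h. (u (x + h) - u x) / h) \<longlongrightarrow> deriv u x) (at_right 0)"
      using layer_has_derivative[of x] unfolding DERIV_def by (rule filterlim_mono) (simp_all add: at_le)
    show "\<forall>\<^sub>F h in at_right 0. (u (x + h) - u x) / h \<le> K"
      using eventually_at_right_less[of 0] by eventually_elim (use K in \<open>simp add: pos_divide_le_eq\<close>)
  qed simp
  have "set_integrable lborel (einterval (-\<infinity>) \<infinity>) (deriv u)"
    by (rule interval_integral_FTC_nonneg(1)[of "-\<infinity>" \<infinity> u "deriv u" 0 1])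
      (use layer_has_derivative layer_deriv_isCont layer_deriv_pos layer_tendsto in
        \<open>auto simp: at_bot_def[symmetric] ereal_tendsto_simps less_imp_le\<close>)
  then have int: "integrable lborel (deriv u)" by (simp add: set_integrable_def)
  have cont: "continuous_on UNIV (deriv u)"
    by (simp add: continuous_at_imp_continuous_on layer_deriv_isCont)
  show ?thesis
  proof (rule Bochner_Integration.integrable_bound)
    show "integrable lborel (\<lambda>x. K * deriv u x)" using int by simp
    show "(\<lambda>x. (deriv u x)\<^sup>2) \<in> borel_measurable lborel"
      using borel_measurable_continuous_onI[OF cont] by simp
    have "(deriv u x)\<^sup>2 \<le> K * deriv u x" for x
      using bound[of x] layer_deriv_pos[of x] by (simp add: power2_eq_square mult_right_mono)
    then show "AE x in lborel. norm ((deriv u x)\<^sup>2) \<le> norm (K * deriv u x)"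
      using layer_deriv_pos K by (auto simp: abs_mult less_imp_le)
  qed
qed

text \<open>Without integrability the integral would be 0 by convention, and so would
  \<open>layer_gamma u\<close>. With it, a vanishing integral would force \<open>deriv u\<close> to
  vanish almost everywhere.\<close>

lemma layer_gamma_pos: "0 < layer_gamma u"
proof -
  have "0 \<le> (LINT x|lborel. (deriv u x)\<^sup>2)" by simp
  moreover have "(LINT x|lborel. (deriv u x)\<^sup>2) \<noteq> 0"
  proof
    assume "(LINT x|lborel. (deriv u x)\<^sup>2) = 0"
    then have "AE x in lborel. (deriv u x)\<^sup>2 = 0"
      using integral_nonneg_eq_0_iff_AE[OF layer_deriv_square_integrable] by simp
    then have "AE x::real in lborel. False"
      by eventually_elim (use layer_deriv_pos in \<open>metis less_irrefl power_eq_0_iff\<close>)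
    then show False using ae_filter_eq_bot_iff[of "lborel :: real measure"] by (simp add: trivial_limit_def)
  qed
  ultimately have "0 < (LINT x|lborel. (deriv u x)\<^sup>2)" by linarith
  then show ?thesis by (simp add: layer_gamma_def)
qed

end

section \<open>The system of gaps\<close>

text \<open>Velocity of a gap \<open>x\<close> adjacent to a gap \<open>y\<close> for alternating
  signs. The term with factor 2 is the mutual attraction of the endpoints of \<open>x\<close>;
  \<open>y powr - p\<close> is the pull of the far particle on the middle one, and
  \<open>(x + y) powr - p\<close> the repulsion of the two outer particles.\<close>

definition gap_rate :: "real \<Rightarrow> real \<Rightarrow> real \<Rightarrow> real \<Rightarrow> real" where
  "gap_rate c p x y = c * (y powr - p + (x + y) powr - p - 2 * x powr - p)"

lemma powr_minus_antimono:
  fixes x y p :: real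
  assumes "0 < x" "x \<le> y" "0 < p"
  shows "y powr - p \<le> x powr - p"
  using assms by (intro powr_mono2') auto

text \<open>Mean value theorem: the derivative has absolute value
  \<open>p * z powr (- p - 1)\<close>, which is largest at the left end \<open>m\<close>.\<close>

lemma powr_minus_lipschitz:
  fixes x y m p :: real
  assumes "0 < m" "m \<le> x" "m \<le> y" "0 < p"
  shows "\<bar>x powr - p - y powr - p\<bar> \<le> p * m powr (- p - 1) * \<bar>x - y\<bar>"
proof -
  have *: "\<bar>x powr - p - y powr - p\<bar> \<le> p * m powr (- p - 1) * \<bar>x - y\<bar>"
    if "m \<le> x" "x < y" for x y
  proof -
    have der: "((\<lambda>z. z powr - p) has_real_derivative - p * z powr (- p - 1)) (at z)"
      if "0 < z" for z
      using that by (auto intro!: derivative_eq_intros)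
    have "\<exists>z>x. z < y \<and> y powr - p - x powr - p = (y - x) * (- p * z powr (- p - 1))"
      by (rule MVT2[OF \<open>x < y\<close>], rule der) (use that \<open>0 < m\<close> in linarith)
    then obtain z where z: "x < z" "z < y"
      "y powr - p - x powr - p = (y - x) * (- p * z powr (- p - 1))"
      by blast
    have "z powr (- p - 1) \<le> m powr (- p - 1)"
      using that z assms by (intro powr_mono2') auto
    moreover have "\<bar>x powr - p - y powr - p\<bar> = (y - x) * (p * z powr (- p - 1))"
      using z(3) that \<open>0 < p\<close> by (subst abs_minus_commute) (simp add: abs_mult)
    ultimately show ?thesis
      using that \<open>0 < p\<close> by (simp add: mult.commute mult_left_mono)
  qed
  show ?thesis
    using *[of x y] *[of y x] assms by (cases x y rule: linorder_cases) (auto simp: abs_minus_commute)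
qed

lemma gap_rate_refl:
  assumes "0 < x"
  shows "gap_rate c p x x = - (c * (1 - 2 powr - p) * x powr - p)"
proof -
  have "(x + x) powr - p = 2 powr - p * x powr - p"
    using assms powr_mult[of 2 x "- p"] by (simp only: mult_2[symmetric])
  then show ?thesis by (simp add: gap_rate_def algebra_simps)
qed

text \<open>For the smaller gap \<open>x\<close>, the lower bound drops the two positive terms and
  the upper bound replaces \<open>y\<close> by \<open>x\<close>, as the rate decreases in
  \<open>y\<close>. The ratio of the two constants, with \<open>p = 2 * s\<close>, is
  \<open>collision_const s\<close>.\<close>

lemma gap_rate_bounds:
  assumes "0 < c" "0 < p" "0 < x" "x \<le> y"
  shows "- (2 * c * x powr - p) \<le> gap_rate c p x y"
    and "gap_rate c p x y \<le> - (c * (1 - 2 powr - p) * x powr - p)"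
    and "gap_rate c p y x \<le> 2 * c * x powr - p"
proof -
  have mono: "y powr - p \<le> x powr - p" "(x + y) powr - p \<le> (x + x) powr - p"
    "(y + x) powr - p \<le> x powr - p" "0 \<le> y powr - p"
    using assms by (auto intro!: powr_minus_antimono)
  show "- (2 * c * x powr - p) \<le> gap_rate c p x y"
    using \<open>0 < c\<close> by (simp add: gap_rate_def algebra_simps)
  have "gap_rate c p x y \<le> gap_rate c p x x"
    unfolding gap_rate_def using mono \<open>0 < c\<close> by (intro mult_left_mono) auto
  then show "gap_rate c p x y \<le> - (c * (1 - 2 powr - p) * x powr - p)"
    using gap_rate_refl \<open>0 < x\<close> by simp
  have "gap_rate c p y x \<le> c * (2 * x powr - p)"
    unfolding gap_rate_def using mono \<open>0 < c\<close> by (intro mult_left_mono) linarith+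
  then show "gap_rate c p y x \<le> 2 * c * x powr - p" by simp
qed

lemma decreasing_bounded_tendsto_at_left:
  fixes f :: "real \<Rightarrow> real"
  assumes T: "t0 < T" and anti: "\<And>r t. \<lbrakk>t0 \<le> r; r \<le> t; t < T\<rbrakk> \<Longrightarrow> f t \<le> f r"
    and lower: "\<And>t. \<lbrakk>t0 \<le> t; t < T\<rbrakk> \<Longrightarrow> l \<le> f t"
  obtains m where "(f \<longlongrightarrow> m) (at_left T)"
proof
  have ne: "f ` {t0..<T} \<noteq> {}" using T by simp
  have bdd: "bdd_below (f ` {t0..<T})" using lower by (auto intro!: bdd_belowI2)
  show "(f \<longlongrightarrow> (INF t\<in>{t0..<T}. f t)) (at_left T)"
  proof (rule order_tendstoI)
    fix y assume y: "y < (INF t\<in>{t0..<T}. f t)"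
    have "y < f t" if "t \<in> {t0<..<T}" for t
      using cINF_lower[OF bdd, of t] that y by auto
    then show "\<forall>\<^sub>F t in at_left T. y < f t"
      using eventually_at_left_real[OF T] by (auto elim: eventually_mono)
  next
    fix y assume "(INF t\<in>{t0..<T}. f t) < y"
    then obtain r where r: "r \<in> {t0..<T}" "f r < y"
      using cINF_less_iff[OF _ bdd] T by auto
    have "f t < y" if "t \<in> {r<..<T}" for t
      using anti[of r t] r that by auto
    then show "\<forall>\<^sub>F t in at_left T. f t < y"
      using eventually_at_left_real[of r T] r by (auto elim: eventually_mono)
  qed
qed

text \<open>Nothing is required at \<open>T\<close>, which may be infinite, and only continuity at
  time 0, as for \<open>particle_solution\<close>; hence continuity is stated on each
  \<open>{0..t}\<close> with \<open>t\<close> below \<open>T\<close>.\<close>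

locale gap_flow =
  fixes c p :: real and T :: ereal and a b :: "real \<Rightarrow> real"
  assumes c_pos: "0 < c" and p_pos: "0 < p" and T_pos: "0 < T"
    and cont_a: "\<And>t. \<lbrakk>0 \<le> t; ereal t < T\<rbrakk> \<Longrightarrow> continuous_on {0..t} a"
    and cont_b: "\<And>t. \<lbrakk>0 \<le> t; ereal t < T\<rbrakk> \<Longrightarrow> continuous_on {0..t} b"
    and a_pos: "\<And>t. \<lbrakk>0 \<le> t; ereal t < T\<rbrakk> \<Longrightarrow> 0 < a t"
    and b_pos: "\<And>t. \<lbrakk>0 \<le> t; ereal t < T\<rbrakk> \<Longrightarrow> 0 < b t"
    and deriv_a: "\<And>t. \<lbrakk>0 < t; ereal t < T\<rbrakk> \<Longrightarrow>
      (a has_real_derivative gap_rate c p (a t) (b t)) (at t)"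
    and deriv_b: "\<And>t. \<lbrakk>0 < t; ereal t < T\<rbrakk> \<Longrightarrow>
      (b has_real_derivative gap_rate c p (b t) (a t)) (at t)"
begin

lemma flip: "gap_flow c p T b a"
  by unfold_locales (auto intro: c_pos p_pos T_pos cont_a cont_b a_pos b_pos deriv_a deriv_b)

lemma less_T_trans: "r \<le> t \<Longrightarrow> ereal t < T \<Longrightarrow> ereal r < T"
  using le_less_trans[of "ereal r" "ereal t" T] by simp

lemma cont_on:
  assumes "0 \<le> r" "ereal t < T"
  shows "continuous_on {r..t} a" "continuous_on {r..t} b"
proof -
  have "continuous_on {r..t} a \<and> continuous_on {r..t} b"
  proof (cases "r \<le> t")
    case True
    then have "0 \<le> t" using assms by simp
    then show ?thesis
      using assms continuous_on_subset[OF cont_a[of t], of "{r..t}"]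
        continuous_on_subset[OF cont_b[of t], of "{r..t}"] by auto
  qed simp
  then show "continuous_on {r..t} a" "continuous_on {r..t} b" by auto
qed

lemma nonneg_deriv_mono:
  assumes rt: "0 \<le> r" "r \<le> t" "ereal t < T"
    and cont: "continuous_on {r..t} f"
    and der: "\<And>z. \<lbrakk>0 < z; ereal z < T; z < t\<rbrakk> \<Longrightarrow> (f has_real_derivative f' z) (at z)"
    and nonneg: "\<And>z. \<lbrakk>0 < z; ereal z < T; z < t\<rbrakk> \<Longrightarrow> 0 \<le> f' z"
  shows "f r \<le> f t"
proof (rule DERIV_nonneg_imp_increasing_open[OF rt(2) _ cont])
  fix z assume z: "r < z" "z < t"
  then have "0 < z" "ereal z < T" using rt less_T_trans[of z t] by auto
  then show "\<exists>y. (f has_real_derivative y) (at z) \<and> 0 \<le> y"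
    using z der nonneg by blast
qed

text \<open>The terms in \<open>a + b\<close> cancel in the difference of the two rates. The factors
  \<open>b - a\<close> and \<open>a powr - p - b powr - p\<close> have the same sign, so the square
  grows whichever gap is smaller.\<close>

lemma gap_difference_square_mono:
  assumes "0 \<le> r" "r \<le> t" "ereal t < T"
  shows "(b r - a r)\<^sup>2 \<le> (b t - a t)\<^sup>2"
proof (rule nonneg_deriv_mono[OF assms])
  show "continuous_on {r..t} (\<lambda>t. (b t - a t)\<^sup>2)"
    using assms by (intro continuous_intros cont_on)
  fix z assume z: "0 < z" "ereal z < T"
  define e where "e = (b z - a z) * (a z powr - p - b z powr - p)"
  show "((\<lambda>t. (b t - a t)\<^sup>2) has_real_derivative 6 * c * e) (at z)"
    by (rule derivative_eq_intros deriv_a deriv_b z refl)+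
      (simp add: e_def gap_rate_def algebra_simps)
  have "0 \<le> e"
    unfolding e_def
    using powr_minus_antimono[of "a z" "b z" p] powr_minus_antimono[of "b z" "a z" p] z
      a_pos[of z] b_pos[of z] p_pos
    by (cases "a z \<le> b z") (auto intro: mult_nonneg_nonneg mult_nonpos_nonpos)
  then show "0 \<le> 6 * c * e" using c_pos by simp
qed

text \<open>Uniqueness by Gronwall's argument: away from collisions the right-hand side is Lipschitz, so
  the square of the difference grows at most exponentially.\<close>

lemma equal_gaps_persist:
  assumes eq: "a 0 = b 0" and t: "0 \<le> t" "ereal t < T"
  shows "a t = b t"
proof -
  obtain za where za: "za \<in> {0..t}" "\<And>z. z \<in> {0..t} \<Longrightarrow> a za \<le> a z"
    using continuous_attains_inf[of "{0..t}" a] cont_on[of 0 t] t by auto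
  obtain zb where zb: "zb \<in> {0..t}" "\<And>z. z \<in> {0..t} \<Longrightarrow> b zb \<le> b z"
    using continuous_attains_inf[of "{0..t}" b] cont_on[of 0 t] t by auto
  define m where "m = min (a za) (b zb)"
  have m: "0 < m" using a_pos b_pos za zb less_T_trans[of _ t] t by (auto simp: m_def)
  have m_le: "m \<le> a z" "m \<le> b z" if "z \<in> {0..t}" for z
    using za(2)[OF that] zb(2)[OF that] by (auto simp: m_def)
  \<comment> \<open>On \<open>[m, \<infinity>)\<close> the function \<open>z powr - p\<close> has
    Lipschitz constant \<open>p * m powr (- p - 1)\<close>, so \<open>L\<close> bounds the growth
    rate of the squared difference. The minus sign in \<open>D\<close> makes it nondecreasing, and
    it starts at 0.\<close>
  define L where "L = 6 * c * (p * m powr (- p - 1))"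
  define D where "D = (\<lambda>z. - ((b z - a z)\<^sup>2 * exp (- L * z)))"
  have "D 0 \<le> D t"
  proof (rule nonneg_deriv_mono[OF order_refl t])
    show "continuous_on {0..t} D"
      unfolding D_def using t by (intro continuous_intros cont_on) auto
    fix z assume z: "0 < z" "ereal z < T" "z < t"
    define e where "e = a z powr - p - b z powr - p"
    show "(D has_real_derivative
        (L * (b z - a z)\<^sup>2 - 6 * c * ((b z - a z) * e)) * exp (- L * z)) (at z)"
      unfolding D_def e_def
      by (rule derivative_eq_intros deriv_a deriv_b z refl)+
        (simp add: gap_rate_def power2_eq_square algebra_simps)
    have "(b z - a z) * e \<le> \<bar>b z - a z\<bar> * \<bar>e\<bar>"
      by (metis abs_ge_self abs_mult)
    also have "\<dots> \<le> \<bar>b z - a z\<bar> * (p * m powr (- p - 1) * \<bar>a z - b z\<bar>)"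
      unfolding e_def using z m m_le[of z] p_pos
      by (intro mult_left_mono powr_minus_lipschitz) auto
    also have "\<dots> = p * m powr (- p - 1) * (b z - a z)\<^sup>2"
      by (simp add: power2_eq_square abs_minus_commute[of "a z"] mult_ac)
    finally have "6 * c * ((b z - a z) * e) \<le> 6 * c * (p * m powr (- p - 1) * (b z - a z)\<^sup>2)"
      using c_pos by (intro mult_left_mono) auto
    then show "0 \<le> (L * (b z - a z)\<^sup>2 - 6 * c * ((b z - a z) * e)) * exp (- L * z)"
      by (intro mult_nonneg_nonneg) (auto simp: L_def mult_ac)
  qed
  then have "(b t - a t)\<^sup>2 * exp (- L * t) \<le> 0" using eq by (simp add: D_def)
  then have "(b t - a t)\<^sup>2 \<le> 0" by (simp add: mult_le_0_iff)
  then show ?thesis by simp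
qed

text \<open>If the order failed, the intermediate value theorem would give a time of equal gaps,
  although the squared difference starts positive and cannot decrease.\<close>

lemma strict_order_preserved:
  assumes less: "a 0 < b 0" and t: "0 \<le> t" "ereal t < T"
  shows "a t < b t"
proof (rule ccontr)
  assume "\<not> a t < b t"
  then obtain z where z: "0 \<le> z" "z \<le> t" "b z - a z = 0"
    using IVT2'[of "\<lambda>z. b z - a z" t 0 0] less t continuous_on_diff[OF cont_on(2,1)[of 0 t]] by auto
  then have "(b 0 - a 0)\<^sup>2 \<le> (b z - a z)\<^sup>2"
    using t less_T_trans[of z t] by (intro gap_difference_square_mono) auto
  then show False using z less by simp
qed

end

section \<open>Decay of the smaller gap and its collision time\<close>

locale ordered_gap_flow = gap_flow +
  assumes ordered0: "a 0 \<le> b 0"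
begin

lemma order_preserved: "\<lbrakk>0 \<le> t; ereal t < T\<rbrakk> \<Longrightarrow> a t \<le> b t"
  using strict_order_preserved[of t] equal_gaps_persist[of t] ordered0 by fastforce

definition \<kappa> :: real where
  "\<kappa> = c * (1 - 2 powr - p)"

lemma \<kappa>_pos: "0 < \<kappa>"
  using c_pos p_pos powr_less_mono[of "- p" 0 2] by (simp add: \<kappa>_def)

lemma rate_a: "\<lbrakk>0 \<le> t; ereal t < T\<rbrakk> \<Longrightarrow> - (2 * c * a t powr - p) \<le> gap_rate c p (a t) (b t)"
  "\<lbrakk>0 \<le> t; ereal t < T\<rbrakk> \<Longrightarrow> gap_rate c p (a t) (b t) \<le> - (\<kappa> * a t powr - p)"
  "\<lbrakk>0 \<le> t; ereal t < T\<rbrakk> \<Longrightarrow> gap_rate c p (b t) (a t) \<le> 2 * c * a t powr - p"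
  using gap_rate_bounds[OF c_pos p_pos] a_pos order_preserved by (auto simp: \<kappa>_def)

text \<open>The power \<open>p + 1\<close> cancels the singularity: \<open>a t powr p\<close> times
  the rate lies between the constants \<open>- 2 * c\<close> and \<open>- \<kappa>\<close>, so the
  bounds integrate to linear functions of time.\<close>

lemma deriv_a_powr:
  assumes t: "0 < t" "ereal t < T"
  shows "((\<lambda>t. a t powr (p + 1)) has_real_derivative
    (p + 1) * (a t powr p * gap_rate c p (a t) (b t))) (at t)"
proof -
  have pos: "0 < a t" using a_pos[of t] t by simp
  have "((\<lambda>t. a t powr (p + 1)) has_real_derivative
      (p + 1) * a t powr (p + 1 - 1) * gap_rate c p (a t) (b t)) (at t)"
    using DERIV_fun_powr[OF deriv_a[OF t] pos, of "p + 1"] by simp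
  then show ?thesis by (simp add: mult.assoc)
qed

lemma cont_a_powr:
  assumes rt: "0 \<le> r" "ereal t < T"
  shows "continuous_on {r..t} (\<lambda>t. a t powr (p + 1))"
proof -
  have "a z \<noteq> 0" if "z \<in> {r..t}" for z
    using a_pos[of z] less_T_trans[of z t] that rt by auto
  then show ?thesis using rt by (intro continuous_intros cont_on) auto
qed

lemma powr_p_mult_minus: "\<lbrakk>0 \<le> t; ereal t < T\<rbrakk> \<Longrightarrow> a t powr p * a t powr - p = 1"
  using a_pos[of t] by (simp flip: powr_add)

lemma a_powr_lower:
  assumes t: "0 \<le> t" "ereal t < T"
  shows "a 0 powr (p + 1) - 2 * c * (p + 1) * t \<le> a t powr (p + 1)"
proof -
  \<comment> \<open>The summand with \<open>* 0\<close> makes both sides values of one function, at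
    0 and at \<open>t\<close>.\<close>
  have "a 0 powr (p + 1) + 2 * c * (p + 1) * 0 \<le> a t powr (p + 1) + 2 * c * (p + 1) * t"
  proof (rule nonneg_deriv_mono[OF order_refl t])
    show "continuous_on {0..t} (\<lambda>t. a t powr (p + 1) + 2 * c * (p + 1) * t)"
      using t by (intro continuous_intros cont_a_powr) auto
    fix z assume z: "0 < z" "ereal z < T"
    show "((\<lambda>t. a t powr (p + 1) + 2 * c * (p + 1) * t) has_real_derivative
        (p + 1) * (a z powr p * gap_rate c p (a z) (b z)) + 2 * c * (p + 1)) (at z)"
      by (rule derivative_eq_intros deriv_a_powr z refl)+ simp
    have "a z powr p * - (2 * c * a z powr - p) \<le> a z powr p * gap_rate c p (a z) (b z)"
      using z by (intro mult_left_mono rate_a) auto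
    moreover have "a z powr p * - (2 * c * a z powr - p) = - (2 * c)"
      using powr_p_mult_minus[OF less_imp_le[OF z(1)] z(2)] by algebra
    ultimately have "0 \<le> a z powr p * gap_rate c p (a z) (b z) + 2 * c"
      by linarith
    then have "0 \<le> (p + 1) * (a z powr p * gap_rate c p (a z) (b z) + 2 * c)"
      using p_pos by (intro mult_nonneg_nonneg) auto
    then show "0 \<le> (p + 1) * (a z powr p * gap_rate c p (a z) (b z)) + 2 * c * (p + 1)"
      by (simp add: algebra_simps)
  qed
  then show ?thesis by simp
qed

lemma a_powr_upper:
  assumes t: "0 \<le> t" "ereal t < T"
  shows "a t powr (p + 1) \<le> a 0 powr (p + 1) - \<kappa> * (p + 1) * t"
proof -
  have "- (a 0 powr (p + 1)) - \<kappa> * (p + 1) * 0 \<le> - (a t powr (p + 1)) - \<kappa> * (p + 1) * t"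
  proof (rule nonneg_deriv_mono[OF order_refl t])
    show "continuous_on {0..t} (\<lambda>t. - (a t powr (p + 1)) - \<kappa> * (p + 1) * t)"
      using t by (intro continuous_intros cont_a_powr) auto
    fix z assume z: "0 < z" "ereal z < T"
    show "((\<lambda>t. - (a t powr (p + 1)) - \<kappa> * (p + 1) * t) has_real_derivative
        - ((p + 1) * (a z powr p * gap_rate c p (a z) (b z))) - \<kappa> * (p + 1)) (at z)"
      by (rule derivative_eq_intros deriv_a_powr z refl)+ simp
    have "a z powr p * gap_rate c p (a z) (b z) \<le> a z powr p * - (\<kappa> * a z powr - p)"
      using z by (intro mult_left_mono rate_a) auto
    moreover have "a z powr p * - (\<kappa> * a z powr - p) = - \<kappa>"
      using powr_p_mult_minus[OF less_imp_le[OF z(1)] z(2)] by algebra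
    ultimately have "0 \<le> - (a z powr p * gap_rate c p (a z) (b z)) - \<kappa>"
      by linarith
    then have "0 \<le> (p + 1) * (- (a z powr p * gap_rate c p (a z) (b z)) - \<kappa>)"
      using p_pos by (intro mult_nonneg_nonneg) auto
    then show "0 \<le> - ((p + 1) * (a z powr p * gap_rate c p (a z) (b z))) - \<kappa> * (p + 1)"
      by (simp add: algebra_simps)
  qed
  then show ?thesis by simp
qed

text \<open>Equal gaps stay equal, and then the upper bound for the rate is attained.\<close>

lemma a_powr_equal:
  assumes eq: "a 0 = b 0" and t: "0 \<le> t" "ereal t < T"
  shows "a t powr (p + 1) = a 0 powr (p + 1) - \<kappa> * (p + 1) * t"
proof (rule antisym)
  have "a 0 powr (p + 1) + \<kappa> * (p + 1) * 0 \<le> a t powr (p + 1) + \<kappa> * (p + 1) * t"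
  proof (rule nonneg_deriv_mono[OF order_refl t])
    show "continuous_on {0..t} (\<lambda>t. a t powr (p + 1) + \<kappa> * (p + 1) * t)"
      using t by (intro continuous_intros cont_a_powr) auto
    fix z assume z: "0 < z" "ereal z < T"
    show "((\<lambda>t. a t powr (p + 1) + \<kappa> * (p + 1) * t) has_real_derivative
        (p + 1) * (a z powr p * gap_rate c p (a z) (b z)) + \<kappa> * (p + 1)) (at z)"
      by (rule derivative_eq_intros deriv_a_powr z refl)+ simp
    have "gap_rate c p (a z) (b z) = - (\<kappa> * a z powr - p)"
      using gap_rate_refl[of "a z" c p] a_pos[of z] equal_gaps_persist[OF eq, of z] z by (simp add: \<kappa>_def)
    then have "a z powr p * gap_rate c p (a z) (b z) = - \<kappa>"
      using powr_p_mult_minus[OF less_imp_le[OF z(1)] z(2)] by algebra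
    then show "0 \<le> (p + 1) * (a z powr p * gap_rate c p (a z) (b z)) + \<kappa> * (p + 1)"
      by (simp add: algebra_simps)
  qed
  then show "a 0 powr (p + 1) - \<kappa> * (p + 1) * t \<le> a t powr (p + 1)" by simp
qed (rule a_powr_upper[OF t])

text \<open>At this time the linear upper bound for \<open>a t powr (p + 1)\<close> reaches 0, while
  \<open>a\<close> stays positive before \<open>T\<close>.\<close>

lemma T_le: "T \<le> ereal (a 0 powr (p + 1) / (\<kappa> * (p + 1)))"
proof (rule ccontr)
  define t where "t = a 0 powr (p + 1) / (\<kappa> * (p + 1))"
  assume "\<not> T \<le> ereal (a 0 powr (p + 1) / (\<kappa> * (p + 1)))"
  then have less: "ereal t < T" by (simp add: t_def)
  have t: "0 \<le> t" using \<kappa>_pos p_pos by (simp add: t_def)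
  have "\<kappa> * (p + 1) * t = a 0 powr (p + 1)" using \<kappa>_pos p_pos by (simp add: t_def)
  then have "a t powr (p + 1) \<le> 0" using a_powr_upper[OF t less] by simp
  then show False using a_pos[OF t less] by simp
qed

lemma a_antimono:
  assumes rt: "0 \<le> r" "r \<le> t" "ereal t < T"
  shows "a t \<le> a r"
proof -
  have "- a r \<le> - a t"
  proof (rule nonneg_deriv_mono[OF rt])
    show "continuous_on {r..t} (\<lambda>t. - a t)" using rt by (intro continuous_intros cont_on)
    fix z assume z: "0 < z" "ereal z < T"
    show "((\<lambda>t. - a t) has_real_derivative - gap_rate c p (a z) (b z)) (at z)"
      using z by (intro DERIV_minus deriv_a)
    have "0 \<le> \<kappa> * a z powr - p" using \<kappa>_pos by simp
    then show "0 \<le> - gap_rate c p (a z) (b z)" using rate_a(2)[of z] z by linarith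
  qed
  then show ?thesis by simp
qed

text \<open>The smaller gap shrinks fast enough to compensate any growth of the larger one; this keeps the
  larger gap convergent at the collision time.\<close>

lemma b_plus_a_antimono:
  assumes rt: "0 \<le> r" "r \<le> t" "ereal t < T"
  shows "b t + 2 * c / \<kappa> * a t \<le> b r + 2 * c / \<kappa> * a r"
proof -
  have "- b r - 2 * c / \<kappa> * a r \<le> - b t - 2 * c / \<kappa> * a t"
  proof (rule nonneg_deriv_mono[OF rt])
    show "continuous_on {r..t} (\<lambda>t. - b t - 2 * c / \<kappa> * a t)"
      using rt by (intro continuous_intros cont_on)
    fix z assume z: "0 < z" "ereal z < T"
    show "((\<lambda>t. - b t - 2 * c / \<kappa> * a t) has_real_derivative
        - gap_rate c p (b z) (a z) - 2 * c / \<kappa> * gap_rate c p (a z) (b z)) (at z)"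
      using z by (intro DERIV_diff DERIV_minus DERIV_cmult deriv_a deriv_b)
    \<comment> \<open>The weight \<open>2 * c / \<kappa>\<close> converts the decay bound of
      \<open>a\<close> into exactly the growth bound of \<open>b\<close>.\<close>
    have "2 * c / \<kappa> * gap_rate c p (a z) (b z) \<le> 2 * c / \<kappa> * - (\<kappa> * a z powr - p)"
      using z c_pos \<kappa>_pos by (intro mult_left_mono rate_a) auto
    also have "\<dots> = - (2 * c * a z powr - p)" using \<kappa>_pos by simp
    finally show "0 \<le> - gap_rate c p (b z) (a z) - 2 * c / \<kappa> * gap_rate c p (a z) (b z)"
      using rate_a(3)[of z] z by linarith
  qed
  then show ?thesis by simp
qed

text \<open>Monotone quantities converge, and the pointwise estimates pass to the limit. A positive
  \<open>al\<close> is still possible here; maximality excludes it later.\<close>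

lemma limits_at_T:
  obtains tc al bl where "T = ereal tc" "0 < tc" "tc \<le> a 0 powr (p + 1) / (\<kappa> * (p + 1))"
    "(a \<longlongrightarrow> al) (at_left tc)" "(b \<longlongrightarrow> bl) (at_left tc)"
    "0 \<le> al" "al \<le> bl" "(b 0 - a 0)\<^sup>2 \<le> (bl - al)\<^sup>2"
    "a 0 powr (p + 1) - 2 * c * (p + 1) * tc \<le> al powr (p + 1)"
    "a 0 = b 0 \<Longrightarrow> al = bl"
    "a 0 = b 0 \<Longrightarrow> al powr (p + 1) = a 0 powr (p + 1) - \<kappa> * (p + 1) * tc"
proof -
  obtain tc where tc: "T = ereal tc" using T_le T_pos by (cases T) auto
  have tc_pos: "0 < tc" using T_pos tc by (simp flip: zero_ereal_def)
  have below: "ereal t < T \<longleftrightarrow> t < tc" for t by (simp add: tc)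
  obtain al where al: "(a \<longlongrightarrow> al) (at_left tc)"
    using decreasing_bounded_tendsto_at_left[of 0 tc a 0] a_antimono a_pos tc_pos
    by (auto simp: below less_imp_le)
  define K where "K = 2 * c / \<kappa>"
  have K: "0 < K" using c_pos \<kappa>_pos by (simp add: K_def)
  have pos: "0 \<le> b t + K * a t" if "0 \<le> t" "t < tc" for t
    using a_pos[of t] b_pos[of t] K that by (simp add: below less_imp_le)
  obtain q where q: "((\<lambda>t. b t + K * a t) \<longlongrightarrow> q) (at_left tc)"
    using decreasing_bounded_tendsto_at_left[of 0 tc "\<lambda>t. b t + K * a t" 0]
      b_plus_a_antimono pos tc_pos by (auto simp: below K_def)
  \<comment> \<open>The larger gap need not be monotone; its limit comes from writing
    \<open>b\<close> as \<open>(b + K * a) - K * a\<close>.\<close>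
  define bl where "bl = q - K * al"
  have bl: "(b \<longlongrightarrow> bl) (at_left tc)"
    using tendsto_diff[OF q tendsto_mult[OF tendsto_const[of K] al]] by (simp add: bl_def)
  have ev: "\<forall>\<^sub>F t in at_left tc. t \<in> {0<..<tc}"
    using eventually_at_left_real[OF tc_pos] .
  have ev': "\<forall>\<^sub>F t in at_left tc. P t" if "\<And>t. 0 \<le> t \<Longrightarrow> ereal t < T \<Longrightarrow> P t" for P
    using ev by eventually_elim (use that in \<open>simp add: below\<close>)
  \<comment> \<open>Since \<open>al\<close> may be 0, continuity of \<open>powr\<close> needs the
    nonnegative base and the positive exponent.\<close>
  have apowr: "((\<lambda>t. a t powr (p + 1)) \<longlongrightarrow> al powr (p + 1)) (at_left tc)"
  proof (rule tendsto_powr2[OF al tendsto_const])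
    show "\<forall>\<^sub>F t in at_left tc. 0 \<le> a t" using a_pos by (intro ev') (simp add: less_imp_le)
  qed (use p_pos in simp)
  have lin: "((\<lambda>t. a 0 powr (p + 1) - C * t) \<longlongrightarrow> a 0 powr (p + 1) - C * tc) (at_left tc)" for C
    by (intro tendsto_intros)
  show thesis
  proof
    show "tc \<le> a 0 powr (p + 1) / (\<kappa> * (p + 1))" using T_le tc by simp
    show "0 \<le> al"
      by (rule tendsto_lowerbound[OF al ev']) (simp_all add: a_pos less_imp_le)
    show "al \<le> bl"
      by (rule tendsto_le[OF _ bl al ev']) (simp_all add: order_preserved)
    show "(b 0 - a 0)\<^sup>2 \<le> (bl - al)\<^sup>2"
      by (rule tendsto_lowerbound[OF tendsto_power[OF tendsto_diff[OF bl al]] ev'])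
        (simp_all add: gap_difference_square_mono)
    show "a 0 powr (p + 1) - 2 * c * (p + 1) * tc \<le> al powr (p + 1)"
      by (rule tendsto_le[OF _ apowr lin ev']) (simp_all add: a_powr_lower)
    assume eq: "a 0 = b 0"
    have "(b \<longlongrightarrow> al) (at_left tc)"
      using al by (rule Lim_transform_eventually, intro ev') (simp add: equal_gaps_persist eq)
    then show "al = bl" using bl tendsto_unique trivial_limit_at_left_real by blast
    have "((\<lambda>t. a t powr (p + 1)) \<longlongrightarrow> a 0 powr (p + 1) - \<kappa> * (p + 1) * tc) (at_left tc)"
      using lin by (rule Lim_transform_eventually, intro ev') (simp add: a_powr_equal[OF eq])
    then show "al powr (p + 1) = a 0 powr (p + 1) - \<kappa> * (p + 1) * tc"
      using apowr tendsto_unique trivial_limit_at_left_real by blast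
  qed (use tc tc_pos al bl in auto)
qed

end

section \<open>Local existence and continuation\<close>

text \<open>The integral operator is a contraction on the complete space of bounded continuous
  functions, and its fixed point solves the integral equation.\<close>

lemma picard_local_existence:
  fixes F :: "'a :: banach \<Rightarrow> 'a"
  assumes L: "0 < L" and lip: "\<And>x y. dist (F x) (F y) \<le> L * dist x y"
  obtains z \<delta> where "0 < \<delta>" "z 0 = z0"
    "\<And>t. t \<in> {0..\<delta>} \<Longrightarrow> (z has_vector_derivative F (z t)) (at t within {0..\<delta>})"
proof -
  \<comment> \<open>This length makes the contraction factor \<open>L * \<delta>\<close> equal to
    \<open>1 / 2\<close>.\<close>
  define \<delta> where "\<delta> = 1 / (2 * L)"
  have \<delta>: "0 < \<delta>" using L by (simp add: \<delta>_def)
  \<comment> \<open>Elements of the function space live on the whole line; clamping time to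
    \<open>{0..\<delta>}\<close> makes the operator produce bounded functions there.\<close>
  define cl where "cl = (\<lambda>t. max 0 (min \<delta> t))"
  have cl: "cl t \<in> {0..\<delta>}" for t using \<delta> by (auto simp: cl_def)
  have cl_id: "cl t = t" if "t \<in> {0..\<delta>}" for t using that by (auto simp: cl_def)
  have cont_cl: "continuous_on UNIV cl" unfolding cl_def by (intro continuous_intros)
  have cont_F: "continuous_on UNIV F"
  proof (rule lipschitz_on_continuous_on)
    show "L-lipschitz_on UNIV F" using lip L by (auto intro: lipschitz_onI)
  qed
  define I where "I = (\<lambda>(g :: real \<Rightarrow>\<^sub>C 'a) t. z0 + integral {0..t} (\<lambda>s. F (g s)))"
  have cont_Fg: "continuous_on A (\<lambda>s. F (apply_bcontfun g s))" for A :: "real set" and g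
    by (rule continuous_on_compose2[OF cont_F]) auto
  have deriv_I: "(I g has_vector_derivative F (g t)) (at t within {0..\<delta>})" if "t \<in> {0..\<delta>}" for g t
    unfolding I_def using integral_has_vector_derivative[OF cont_Fg that]
    by (auto intro!: derivative_eq_intros)
  have cont_I: "continuous_on {0..\<delta>} (I g)" for g
    using deriv_I by (meson continuous_on_eq_continuous_within has_vector_derivative_continuous)
  have bcont: "(\<lambda>t. I g (cl t)) \<in> bcontfun" for g
  proof -
    have "continuous_on UNIV (\<lambda>t. I g (cl t))"
      using cl by (intro continuous_on_compose2[OF cont_I cont_cl]) auto
    moreover have "bounded (range (\<lambda>t. I g (cl t)))"
      using cl by (intro bounded_subset[OF compact_imp_bounded[OF compact_continuous_image[OF cont_I compact_Icc]]]) auto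
    ultimately show ?thesis by (simp add: bcontfun_def)
  qed
  define P where "P = (\<lambda>g. Bcontfun (\<lambda>t. I g (cl t)))"
  have P: "apply_bcontfun (P g) = (\<lambda>t. I g (cl t))" for g
    unfolding P_def using bcont by (rule Bcontfun_inverse)
  have "dist (P g) (P h) \<le> 1 / 2 * dist g h" for g h
  proof (rule dist_bound)
    fix t
    have int: "(\<lambda>s. F (apply_bcontfun g s)) integrable_on {0..cl t}" for g
      by (rule integrable_continuous_interval[OF cont_Fg])
    have "dist (P g t) (P h t) = norm (integral {0..cl t} (\<lambda>s. F (g s) - F (h s)))"
      by (simp add: P I_def dist_norm Henstock_Kurzweil_Integration.integral_diff[OF int int])
    also have "\<dots> \<le> L * dist g h * (cl t - 0)"
    proof (rule integral_bound)
      show "continuous_on {0..cl t} (\<lambda>s. F (g s) - F (h s))"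
        by (intro continuous_intros cont_Fg)
      fix s
      have "norm (F (g s) - F (h s)) \<le> L * dist (g s) (h s)"
        using lip by (simp add: dist_norm)
      also have "\<dots> \<le> L * dist g h" using L dist_bounded by (intro mult_left_mono) auto
      finally show "norm (F (g s) - F (h s)) \<le> L * dist g h" .
    qed (use cl in auto)
    also have "\<dots> \<le> L * dist g h * \<delta>"
      using cl[of t] L by (intro mult_left_mono) auto
    also have "\<dots> = 1 / 2 * dist g h" using L by (simp add: \<delta>_def)
    finally show "dist (P g t) (P h t) \<le> 1 / 2 * dist g h" .
  qed
  then have "\<exists>!g. P g = g" using banach_fix_type[of "1 / 2" P] by auto
  then obtain g where g: "P g = g" by blast
  have g_eq: "apply_bcontfun g t = I g t" if "t \<in> {0..\<delta>}" for t
    using fun_cong[OF P[of g], of t] cl_id[OF that] unfolding g by simp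
  show ?thesis
  proof
    show "apply_bcontfun g 0 = z0" using g_eq[of 0] \<delta> by (simp add: I_def)
    show "(apply_bcontfun g has_vector_derivative F (g t)) (at t within {0..\<delta>})"
      if "t \<in> {0..\<delta>}" for t
      by (rule has_vector_derivative_transform[OF that g_eq deriv_I[OF that]])
  qed (rule \<delta>)
qed

text \<open>Truncating the gaps from below by \<open>m\<close> removes the singularity and makes the field globally
  Lipschitz, as Picard iteration requires.\<close>

lemma gap_rate_truncated_lipschitz:
  fixes x y x' y' m :: real
  assumes c: "0 < c" and p: "0 < p" and m: "0 < m"
  shows "\<bar>gap_rate c p (max m x) (max m y) - gap_rate c p (max m x') (max m y')\<bar>
    \<le> c * (p * m powr (- p - 1)) * (3 * \<bar>x - x'\<bar> + 2 * \<bar>y - y'\<bar>)"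
proof -
  define K where "K = p * m powr (- p - 1)"
  have K: "0 \<le> K" using p by (simp add: K_def)
  define X Y X' Y' where "X = max m x" and "Y = max m y" and "X' = max m x'" and "Y' = max m y'"
  have ge: "m \<le> X" "m \<le> Y" "m \<le> X'" "m \<le> Y'" by (auto simp: X_def Y_def X'_def Y'_def)
  have dX: "\<bar>X - X'\<bar> \<le> \<bar>x - x'\<bar>" and dY: "\<bar>Y - Y'\<bar> \<le> \<bar>y - y'\<bar>"
    by (auto simp: X_def Y_def X'_def Y'_def max_def)
  have lip: "\<bar>v powr - p - w powr - p\<bar> \<le> K * d" if "m \<le> v" "m \<le> w" "\<bar>v - w\<bar> \<le> d" for v w d
  proof -
    have "\<bar>v powr - p - w powr - p\<bar> \<le> K * \<bar>v - w\<bar>"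
      using powr_minus_lipschitz[OF m that(1,2) p] by (simp add: K_def)
    also have "\<dots> \<le> K * d" using that K by (intro mult_left_mono) auto
    finally show ?thesis .
  qed
  have "\<bar>X powr - p - X' powr - p\<bar> \<le> K * \<bar>x - x'\<bar>"
    "\<bar>Y powr - p - Y' powr - p\<bar> \<le> K * \<bar>y - y'\<bar>"
    "\<bar>(X + Y) powr - p - (X' + Y') powr - p\<bar> \<le> K * (\<bar>x - x'\<bar> + \<bar>y - y'\<bar>)"
    using ge dX dY m by (intro lip; linarith)+
  then have "\<bar>(Y powr - p + (X + Y) powr - p - 2 * X powr - p)
      - (Y' powr - p + (X' + Y') powr - p - 2 * X' powr - p)\<bar>
    \<le> K * \<bar>y - y'\<bar> + K * (\<bar>x - x'\<bar> + \<bar>y - y'\<bar>) + 2 * (K * \<bar>x - x'\<bar>)"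
    by linarith
  also have "\<dots> = K * (3 * \<bar>x - x'\<bar> + 2 * \<bar>y - y'\<bar>)" by (simp add: algebra_simps)
  finally have "c * \<bar>(Y powr - p + (X + Y) powr - p - 2 * X powr - p)
      - (Y' powr - p + (X' + Y') powr - p - 2 * X' powr - p)\<bar>
    \<le> c * (K * (3 * \<bar>x - x'\<bar> + 2 * \<bar>y - y'\<bar>))"
    using c by (intro mult_left_mono) auto
  then show ?thesis
    using c unfolding gap_rate_def right_diff_distrib[symmetric] abs_mult X_def Y_def X'_def Y'_def K_def
    by (simp add: mult.assoc)
qed

text \<open>The truncated system is solved with \<open>m\<close> half the smaller initial gap. By
  continuity both gaps stay above \<open>m\<close> for a short time, during which the truncation is
  inactive.\<close>

lemma gap_flow_local_existence:
  assumes c: "0 < c" and p: "0 < p" and x0: "0 < x0" and y0: "0 < y0"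
  obtains X Y \<delta> where "0 < \<delta>" "X 0 = x0" "Y 0 = y0"
    "\<And>t. t \<in> {0..\<delta>} \<Longrightarrow> 0 < X t" "\<And>t. t \<in> {0..\<delta>} \<Longrightarrow> 0 < Y t"
    "\<And>t. t \<in> {0..\<delta>} \<Longrightarrow>
      (X has_real_derivative gap_rate c p (X t) (Y t)) (at t within {0..\<delta>})"
    "\<And>t. t \<in> {0..\<delta>} \<Longrightarrow>
      (Y has_real_derivative gap_rate c p (Y t) (X t)) (at t within {0..\<delta>})"
proof -
  define m where "m = min x0 y0 / 2"
  have m: "0 < m" "m < x0" "m < y0" using x0 y0 by (auto simp: m_def min_def)
  define R where "R = (\<lambda>x y. gap_rate c p (max m x) (max m y))"
  define F where "F = (\<lambda>z. (R (fst z) (snd z), R (snd z) (fst z)))"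
  define K where "K = c * (p * m powr (- p - 1))"
  have K: "0 < K" using c p m by (simp add: K_def)
  have lip: "dist (F z) (F w) \<le> 10 * K * dist z w" for z w
  proof -
    have d: "\<bar>fst z - fst w\<bar> \<le> dist z w" "\<bar>snd z - snd w\<bar> \<le> dist z w"
      using dist_fst_le[of z w] dist_snd_le[of z w] by (auto simp: dist_real_def)
    have "dist (F z) (F w) \<le> \<bar>fst (F z) - fst (F w)\<bar> + \<bar>snd (F z) - snd (F w)\<bar>"
      unfolding dist_prod_def by (simp add: dist_real_def sqrt_sum_squares_le_sum_abs)
    also have "\<dots> \<le> K * (3 * \<bar>fst z - fst w\<bar> + 2 * \<bar>snd z - snd w\<bar>)
        + K * (3 * \<bar>snd z - snd w\<bar> + 2 * \<bar>fst z - fst w\<bar>)"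
      unfolding F_def R_def K_def using gap_rate_truncated_lipschitz[OF c p m(1)]
      by (intro add_mono) auto
    also have "\<dots> = K * (5 * \<bar>fst z - fst w\<bar> + 5 * \<bar>snd z - snd w\<bar>)"
      by (simp add: algebra_simps)
    also have "\<dots> \<le> K * (10 * dist z w)"
      using d K by (intro mult_left_mono) auto
    finally show ?thesis by simp
  qed
  obtain z \<delta> where \<delta>: "0 < \<delta>" and z0: "z 0 = (x0, y0)"
    and z: "\<And>t. t \<in> {0..\<delta>} \<Longrightarrow> (z has_vector_derivative F (z t)) (at t within {0..\<delta>})"
    by (rule picard_local_existence[of "10 * K" F "(x0, y0)"]) (use lip K in auto)
  have derX: "((\<lambda>t. fst (z t)) has_real_derivative R (fst (z t)) (snd (z t))) (at t within {0..\<delta>})"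
    and derY: "((\<lambda>t. snd (z t)) has_real_derivative R (snd (z t)) (fst (z t))) (at t within {0..\<delta>})"
    if "t \<in> {0..\<delta>}" for t
    using bounded_linear.has_vector_derivative[OF bounded_linear_fst z[OF that]]
      bounded_linear.has_vector_derivative[OF bounded_linear_snd z[OF that]]
    by (simp_all add: F_def has_real_derivative_iff_has_vector_derivative)
  have "((\<lambda>t. fst (z t)) \<longlongrightarrow> x0) (at_right 0)" "((\<lambda>t. snd (z t)) \<longlongrightarrow> y0) (at_right 0)"
    using DERIV_continuous[OF derX[of 0]] DERIV_continuous[OF derY[of 0]] \<delta> z0
    by (simp_all add: continuous_within at_within_Icc_at_right)
  then have "\<forall>\<^sub>F t in at_right 0. m < fst (z t) \<and> m < snd (z t)"
    using m by (intro eventually_conj order_tendstoD)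
  then obtain e where e: "0 < e" "\<And>t. 0 < t \<Longrightarrow> t < e \<Longrightarrow> m < fst (z t) \<and> m < snd (z t)"
    unfolding eventually_at_right_field by auto
  \<comment> \<open>Halving \<open>e\<close> keeps the closed interval \<open>{0..d}\<close>
    strictly below \<open>e\<close>.\<close>
  define d where "d = min \<delta> (e / 2)"
  have d: "0 < d" "d \<le> \<delta>" "d < e" using e \<delta> by (auto simp: d_def)
  have gt: "m < fst (z t) \<and> m < snd (z t)" if "t \<in> {0..d}" for t
    using e(2)[of t] that d z0 m by (cases "t = 0") auto
  have sub: "{0..d} \<subseteq> {0..\<delta>}" using d by auto
  show ?thesis
  proof
    fix t assume t: "t \<in> {0..d}"
    show "((\<lambda>t. fst (z t)) has_real_derivative gap_rate c p (fst (z t)) (snd (z t))) (at t within {0..d})"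
      "((\<lambda>t. snd (z t)) has_real_derivative gap_rate c p (snd (z t)) (fst (z t))) (at t within {0..d})"
      using DERIV_subset[OF derX sub, of t] DERIV_subset[OF derY sub, of t] t sub gt[OF t]
      by (auto simp: R_def max_def)
    show "0 < fst (z t)" "0 < snd (z t)" using gt[OF t] m by auto
  qed (use d z0 in auto)
qed

text \<open>By l'Hospital's rule. This supplies the derivative at the time where two solutions are
  glued, with equations known only on either side.\<close>

lemma has_real_derivative_from_limit:
  fixes f g :: "real \<Rightarrow> real"
  assumes f: "isCont f x" and g: "isCont g x"
    and ev: "\<forall>\<^sub>F t in at x. (f has_real_derivative g t) (at t)"
  shows "(f has_real_derivative g x) (at x)"
proof -
  have "((\<lambda>t. (f t - f x) / (t - x)) \<longlongrightarrow> g x) (at x)"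
  proof (rule lhopital)
    show "((\<lambda>t. f t - f x) \<longlongrightarrow> 0) (at x)" using f by (simp add: isCont_def LIM_zero)
    show "((\<lambda>t. t - x) \<longlongrightarrow> 0) (at x)" by (simp add: LIM_zero)
    show "\<forall>\<^sub>F t in at x. t - x \<noteq> 0" by (simp add: eventually_at_filter)
    show "\<forall>\<^sub>F t in at x. (1::real) \<noteq> 0" by simp
    show "\<forall>\<^sub>F t in at x. ((\<lambda>t. f t - f x) has_real_derivative g t) (at t)"
      using ev by eventually_elim (auto intro!: derivative_eq_intros)
    show "\<forall>\<^sub>F t in at x. ((\<lambda>t. t - x) has_real_derivative 1) (at t)"
      by (auto intro!: derivative_eq_intros always_eventually)
    show "((\<lambda>t. g t / 1) \<longlongrightarrow> g x) (at x)" using g by (simp add: isCont_def)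
  qed
  then show ?thesis by (simp add: has_field_derivative_iff)
qed

text \<open>The system is restarted at \<open>tc\<close> from the limits \<open>al\<close> and
  \<open>bl\<close>. The glued gaps are continuous and positive at \<open>tc\<close>, so the rates
  are continuous there and the equations extend to \<open>tc\<close>.\<close>

lemma (in gap_flow) continuation:
  assumes T: "T = ereal tc"
    and la: "(a \<longlongrightarrow> al) (at_left tc)" and lb: "(b \<longlongrightarrow> bl) (at_left tc)"
    and al: "0 < al" and bl: "0 < bl"
  obtains A B T' where "T < T'" "gap_flow c p T' A B"
    "\<And>t. t < tc \<Longrightarrow> A t = a t" "\<And>t. t < tc \<Longrightarrow> B t = b t"
proof -
  have tc: "0 < tc" using T_pos T by (simp flip: zero_ereal_def)
  obtain X Y \<delta> where \<delta>: "0 < \<delta>" and XY0: "X 0 = al" "Y 0 = bl"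
    and pos: "\<And>t. t \<in> {0..\<delta>} \<Longrightarrow> 0 < X t" "\<And>t. t \<in> {0..\<delta>} \<Longrightarrow> 0 < Y t"
    and der: "\<And>t. t \<in> {0..\<delta>} \<Longrightarrow>
      (X has_real_derivative gap_rate c p (X t) (Y t)) (at t within {0..\<delta>})"
    "\<And>t. t \<in> {0..\<delta>} \<Longrightarrow>
      (Y has_real_derivative gap_rate c p (Y t) (X t)) (at t within {0..\<delta>})"
    using gap_flow_local_existence[OF c_pos p_pos al bl] by metis
  define A B where "A = (\<lambda>t. if t < tc then a t else X (t - tc))"
    and "B = (\<lambda>t. if t < tc then b t else Y (t - tc))"
  have AB_pos: "0 < A t" "0 < B t" if "0 \<le> t" "t < tc + \<delta>" for t
    using a_pos[of t] b_pos[of t] pos[of "t - tc"] that T by (auto simp: A_def B_def)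
  have before: "(A has_real_derivative gap_rate c p (A t) (B t)) (at t)"
    "(B has_real_derivative gap_rate c p (B t) (A t)) (at t)" if t: "0 < t" "t < tc" for t
  proof -
    have ev: "\<forall>\<^sub>F z in nhds t. z < tc" using t by (intro eventually_nhds_in_open[of "{..<tc}", simplified]) auto
    have "\<forall>\<^sub>F z in nhds t. A z = a z" "\<forall>\<^sub>F z in nhds t. B z = b z"
      using ev by (eventually_elim, simp add: A_def B_def)+
    then show "(A has_real_derivative gap_rate c p (A t) (B t)) (at t)"
      "(B has_real_derivative gap_rate c p (B t) (A t)) (at t)"
      using deriv_a[of t] deriv_b[of t] t T
      by (simp_all add: A_def B_def cong: DERIV_cong_ev)
  qed
  have after: "(A has_real_derivative gap_rate c p (A t) (B t)) (at t)"
    "(B has_real_derivative gap_rate c p (B t) (A t)) (at t)" if t: "tc < t" "t < tc + \<delta>" for t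
  proof -
    have ev: "\<forall>\<^sub>F z in nhds t. tc < z" using t by (intro eventually_nhds_in_open[of "{tc<..}", simplified]) auto
    have ev': "\<forall>\<^sub>F z in nhds t. A z = X (z + - tc)" "\<forall>\<^sub>F z in nhds t. B z = Y (z + - tc)"
      using ev by (eventually_elim, simp add: A_def B_def)+
    have "at (t + - tc) within {0..\<delta>} = at (t + - tc)"
      using t by (intro at_within_interior) simp
    then have "((\<lambda>z. X (z + - tc)) has_real_derivative gap_rate c p (A t) (B t)) (at t)"
      "((\<lambda>z. Y (z + - tc)) has_real_derivative gap_rate c p (B t) (A t)) (at t)"
      using der[of "t + - tc"] t unfolding DERIV_shift[symmetric] by (simp_all add: A_def B_def)
    then show "(A has_real_derivative gap_rate c p (A t) (B t)) (at t)"
      "(B has_real_derivative gap_rate c p (B t) (A t)) (at t)"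
      using DERIV_cong_ev[OF refl ev'(1) refl] DERIV_cong_ev[OF refl ev'(2) refl] by auto
  qed
  have X_right: "((\<lambda>t. X (t - tc)) \<longlongrightarrow> al) (at_right tc)"
    and Y_right: "((\<lambda>t. Y (t - tc)) \<longlongrightarrow> bl) (at_right tc)"
  proof -
    have "(X \<longlongrightarrow> al) (at_right 0)" "(Y \<longlongrightarrow> bl) (at_right 0)"
      using DERIV_continuous[OF der(1)[of 0]] DERIV_continuous[OF der(2)[of 0]] \<delta> XY0
      by (simp_all add: continuous_within at_within_Icc_at_right)
    then show "((\<lambda>t. X (t - tc)) \<longlongrightarrow> al) (at_right tc)" "((\<lambda>t. Y (t - tc)) \<longlongrightarrow> bl) (at_right tc)"
      by (simp_all add: at_right_to_0[of tc] filterlim_filtermap)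
  qed
  have left: "\<forall>\<^sub>F t in at_left tc. t < tc" and right: "\<forall>\<^sub>F t in at_right tc. tc < t"
    by (auto simp: eventually_at_filter)
  have "(A \<longlongrightarrow> al) (at_left tc)" "(B \<longlongrightarrow> bl) (at_left tc)"
    using la lb left by (auto elim!: Lim_transform_eventually eventually_mono simp: A_def B_def)
  moreover have "(A \<longlongrightarrow> al) (at_right tc)" "(B \<longlongrightarrow> bl) (at_right tc)"
    using X_right Y_right right by (auto elim!: Lim_transform_eventually eventually_mono simp: A_def B_def)
  ultimately have cont_tc: "isCont A tc" "isCont B tc"
    using XY0 by (simp_all add: isCont_def filterlim_split_at A_def[abs_def] B_def[abs_def])
  have cont_rate: "isCont (\<lambda>t. gap_rate c p (A t) (B t)) tc" "isCont (\<lambda>t. gap_rate c p (B t) (A t)) tc"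
    unfolding gap_rate_def using AB_pos[of tc] tc \<delta> cont_tc
    by (intro continuous_intros; simp)+
  have ev: "\<forall>\<^sub>F t in at tc. t \<in> {0<..<tc + \<delta>} - {tc}"
    using tc \<delta> by (intro eventually_at_in_open) auto
  have "(A has_real_derivative gap_rate c p (A tc) (B tc)) (at tc)"
    using ev by (intro has_real_derivative_from_limit[OF cont_tc(1) cont_rate(1)])
      (auto elim!: eventually_mono intro: before after simp: neq_iff)
  moreover have "(B has_real_derivative gap_rate c p (B tc) (A tc)) (at tc)"
    using ev by (intro has_real_derivative_from_limit[OF cont_tc(2) cont_rate(2)])
      (auto elim!: eventually_mono intro: before after simp: neq_iff)
  ultimately have deriv: "(A has_real_derivative gap_rate c p (A t) (B t)) (at t)"
    "(B has_real_derivative gap_rate c p (B t) (A t)) (at t)" if "0 < t" "t < tc + \<delta>" for t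
    using before[of t] after[of t] that by (cases t tc rule: linorder_cases; simp)+
  \<comment> \<open>The gaps are not controlled at negative times, so time 0 admits only continuity
    from the right.\<close>
  have cont0: "continuous (at 0 within {0..t}) A" "continuous (at 0 within {0..t}) B" for t
  proof -
    have c0: "continuous (at 0 within {0..tc / 2}) a" "continuous (at 0 within {0..tc / 2}) b"
      using cont_on[of 0 "tc / 2"] tc T by (auto simp: continuous_on_eq_continuous_within)
    have ev: "\<forall>\<^sub>F z in at_right 0. z < tc"
      using eventually_at_right_real[OF tc] by (rule eventually_mono) simp
    have "(a \<longlongrightarrow> a 0) (at_right 0)" "(b \<longlongrightarrow> b 0) (at_right 0)"
      using c0 tc by (simp_all add: continuous_within at_within_Icc_at_right)
    then have lim: "(A \<longlongrightarrow> A 0) (at_right 0)" "(B \<longlongrightarrow> B 0) (at_right 0)"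
      using ev tc by (auto elim!: Lim_transform_eventually eventually_mono simp: A_def B_def)
    have "at 0 within {0..t} \<le> at_right 0"
      unfolding at_within_def by (intro inf_mono order_refl) auto
    then show "continuous (at 0 within {0..t}) A" "continuous (at 0 within {0..t}) B"
      using lim by (auto simp: continuous_within intro: tendsto_mono)
  qed
  have cont: "continuous_on {0..t} A" "continuous_on {0..t} B" if "t < tc + \<delta>" for t
  proof -
    have "continuous (at z within {0..t}) A \<and> continuous (at z within {0..t}) B" if "z \<in> {0..t}" for z
      using cont0[of t] deriv[of z] that \<open>t < tc + \<delta>\<close>
      by (cases "z = 0") (auto intro!: continuous_at_imp_continuous_at_within DERIV_isCont)
    then show "continuous_on {0..t} A" "continuous_on {0..t} B"
      by (auto simp: continuous_on_eq_continuous_within)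
  qed
  show thesis
  proof
    show "T < ereal (tc + \<delta>)" using T \<delta> by simp
    show "gap_flow c p (ereal (tc + \<delta>)) A B"
      using tc \<delta> c_pos p_pos AB_pos deriv cont by unfold_locales auto
  qed (auto simp: A_def B_def)
qed

section \<open>Three particles\<close>

lemma pair_force:
  fixes z s :: real
  assumes "0 < z"
  shows "z / (2 * s * \<bar>z\<bar> powr (1 + 2 * s)) = z powr - (2 * s) / (2 * s)"
    and "- z / (2 * s * \<bar>- z\<bar> powr (1 + 2 * s)) = - (z powr - (2 * s) / (2 * s))"
proof -
  have "z powr (1 + 2 * s) = z * z powr (2 * s)" using assms by (simp add: powr_add)
  moreover have "z powr - (2 * s) = 1 / z powr (2 * s)" by (rule powr_minus_divide)
  ultimately show "z / (2 * s * \<bar>z\<bar> powr (1 + 2 * s)) = z powr - (2 * s) / (2 * s)"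
    using assms by simp
  then show "- z / (2 * s * \<bar>- z\<bar> powr (1 + 2 * s)) = - (z powr - (2 * s) / (2 * s))"
    by simp
qed

lemma three_particle_velocity:
  fixes \<zeta> q :: "nat \<Rightarrow> real"
  assumes \<zeta>: "\<zeta> 1 = 1" "\<zeta> 2 = -1" "\<zeta> 3 = 1"
    and A: "0 < A" "q 2 - q 1 = A" and B: "0 < B" "q 3 - q 2 = B"
  shows "particle_velocity \<gamma> s 3 \<zeta> q 1 = \<gamma> / (2 * s) * (A powr - (2 * s) - (A + B) powr - (2 * s))"
    and "particle_velocity \<gamma> s 3 \<zeta> q 2 = \<gamma> / (2 * s) * (B powr - (2 * s) - A powr - (2 * s))"
    and "particle_velocity \<gamma> s 3 \<zeta> q 3 = \<gamma> / (2 * s) * ((A + B) powr - (2 * s) - B powr - (2 * s))"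
proof -
  have q: "q 2 - q 1 = A" "q 1 - q 2 = - A" "q 3 - q 2 = B" "q 2 - q 3 = - B"
    "q 3 - q 1 = A + B" "q 1 - q 3 = - (A + B)"
    using A B by auto
  have sets: "{1..3} - {1} = {2, 3::nat}" "{1..3} - {2} = {1, 3::nat}" "{1..3} - {3} = {1, 2::nat}"
    by auto
  have AB: "0 < A + B" using A B by simp
  note terms = pair_force[OF A(1), of s] pair_force[OF B(1), of s] pair_force[OF AB, of s]
  have "particle_velocity \<gamma> s 3 \<zeta> q 1
      = \<gamma> * ((\<zeta> 1 * \<zeta> 2) * ((q 1 - q 2) / (2 * s * \<bar>q 1 - q 2\<bar> powr (1 + 2 * s)))
          + (\<zeta> 1 * \<zeta> 3) * ((q 1 - q 3) / (2 * s * \<bar>q 1 - q 3\<bar> powr (1 + 2 * s))))"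
    unfolding particle_velocity_def sets by simp
  then show "particle_velocity \<gamma> s 3 \<zeta> q 1
      = \<gamma> / (2 * s) * (A powr - (2 * s) - (A + B) powr - (2 * s))"
    unfolding q terms \<zeta> by (simp add: diff_divide_distrib algebra_simps)
  have "particle_velocity \<gamma> s 3 \<zeta> q 2
      = \<gamma> * ((\<zeta> 2 * \<zeta> 1) * ((q 2 - q 1) / (2 * s * \<bar>q 2 - q 1\<bar> powr (1 + 2 * s)))
          + (\<zeta> 2 * \<zeta> 3) * ((q 2 - q 3) / (2 * s * \<bar>q 2 - q 3\<bar> powr (1 + 2 * s))))"
    unfolding particle_velocity_def sets by simp
  then show "particle_velocity \<gamma> s 3 \<zeta> q 2
      = \<gamma> / (2 * s) * (B powr - (2 * s) - A powr - (2 * s))"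
    unfolding q terms \<zeta> by (simp add: diff_divide_distrib algebra_simps)
  have "particle_velocity \<gamma> s 3 \<zeta> q 3
      = \<gamma> * ((\<zeta> 3 * \<zeta> 1) * ((q 3 - q 1) / (2 * s * \<bar>q 3 - q 1\<bar> powr (1 + 2 * s)))
          + (\<zeta> 3 * \<zeta> 2) * ((q 3 - q 2) / (2 * s * \<bar>q 3 - q 2\<bar> powr (1 + 2 * s))))"
    unfolding particle_velocity_def sets by simp
  then show "particle_velocity \<gamma> s 3 \<zeta> q 3
      = \<gamma> / (2 * s) * ((A + B) powr - (2 * s) - B powr - (2 * s))"
    unfolding q terms \<zeta> by (simp add: diff_divide_distrib algebra_simps)
qed

text \<open>The left sides are the derivatives of the positions rebuilt from the two gaps and the
  constant sum of positions; each leading 0 is the derivative of that sum.\<close>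

lemma gap_rate_combinations:
  "(0 - 2 * gap_rate c p x y - gap_rate c p y x) / 3 = c * (x powr - p - (x + y) powr - p)"
  "(0 + gap_rate c p x y - gap_rate c p y x) / 3 = c * (y powr - p - x powr - p)"
  "(0 + gap_rate c p x y + 2 * gap_rate c p y x) / 3 = c * ((x + y) powr - p - y powr - p)"
  by (simp_all add: gap_rate_def algebra_simps diff_divide_distrib)

section \<open>From particles to gaps and back\<close>

context
  fixes \<gamma> s :: real and \<zeta> :: "nat \<Rightarrow> real"
  assumes \<gamma>: "0 < \<gamma>" and s: "0 < s" and \<zeta>: "\<zeta> 1 = 1" "\<zeta> 2 = -1" "\<zeta> 3 = 1"
begin

lemma index_set: "{1..3} = {1, 2, 3::nat}" by auto

context
  fixes x0 :: "nat \<Rightarrow> real" and x :: "nat \<Rightarrow> real \<Rightarrow> real" and T :: ereal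
  assumes sol: "particle_solution \<gamma> s 3 \<zeta> x0 x T" and x0: "x0 1 < x0 2" "x0 2 < x0 3"
begin

lemma particles_T_pos: "0 < T" using sol by (simp add: particle_solution_def)

lemma particles_initial: "x 1 0 = x0 1" "x 2 0 = x0 2" "x 3 0 = x0 3"
  using sol by (auto simp: particle_solution_def)

lemma particles_deriv:
  "\<lbrakk>i \<in> {1..3}; 0 < t; ereal t < T\<rbrakk> \<Longrightarrow>
    (x i has_real_derivative particle_velocity \<gamma> s 3 \<zeta> (\<lambda>j. x j t) i) (at t)"
  using sol by (auto simp: particle_solution_def)

lemma particles_cont:
  assumes i: "i \<in> {1..3}" and t: "0 \<le> t" "ereal t < T"
  shows "continuous_on {0..t} (x i)"
  unfolding continuous_on_eq_continuous_within
proof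
  fix z assume z: "z \<in> {0..t}"
  show "continuous (at z within {0..t}) (x i)"
  proof (cases "z = 0")
    case True
    have "at 0 within {0..t} \<le> at_right 0"
      unfolding at_within_def by (intro inf_mono order_refl) auto
    moreover have "(x i \<longlongrightarrow> x i 0) (at_right 0)"
      using sol i unfolding particle_solution_def continuous_within by blast
    ultimately show ?thesis
      unfolding True continuous_within by (rule tendsto_mono)
  next
    case False
    have "ereal z \<le> ereal t" using z by simp
    then have "ereal z < T" using t(2) by (rule le_less_trans)
    then show ?thesis
      using z False particles_deriv[OF i, of z]
      by (auto intro!: continuous_at_imp_continuous_at_within DERIV_isCont)
  qed
qed

text \<open>A change of order would force a collision before \<open>T\<close>, by the intermediate
  value theorem.\<close>

lemma particle_order:
  assumes ij: "i \<in> {1..3}" "j \<in> {1..3}" "x i 0 < x j 0" and t: "0 \<le> t" "ereal t < T"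
  shows "x i t < x j t"
proof (rule ccontr)
  assume "\<not> x i t < x j t"
  moreover have "continuous_on {0..t} (\<lambda>z. x j z - x i z)"
    using ij t by (intro continuous_intros particles_cont)
  ultimately obtain z where z: "0 \<le> z" "z \<le> t" "x j z - x i z = 0"
    using IVT2'[of "\<lambda>z. x j z - x i z" t 0 0] ij t by auto
  have "z \<noteq> 0" using z ij by auto
  have "ereal z \<le> ereal t" using z by simp
  then have "ereal z < T" using t by (meson le_less_trans)
  then show False
    using sol z ij \<open>z \<noteq> 0\<close> unfolding particle_solution_def
    by (metis eq_iff_diff_eq_0 less_irrefl order_le_less)
qed

lemma particles_gap_pos:
  assumes "0 \<le> t" "ereal t < T"
  shows "0 < x 2 t - x 1 t" "0 < x 3 t - x 2 t"
  using particle_order[of 1 2 t] particle_order[of 2 3 t] particles_initial x0 assms by auto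

lemma particles_velocity:
  assumes t: "0 < t" "ereal t < T"
  shows "(x 1 has_real_derivative \<gamma> / (2 * s) *
      ((x 2 t - x 1 t) powr - (2 * s) - (x 3 t - x 1 t) powr - (2 * s))) (at t)"
    and "(x 2 has_real_derivative \<gamma> / (2 * s) *
      ((x 3 t - x 2 t) powr - (2 * s) - (x 2 t - x 1 t) powr - (2 * s))) (at t)"
    and "(x 3 has_real_derivative \<gamma> / (2 * s) *
      ((x 3 t - x 1 t) powr - (2 * s) - (x 3 t - x 2 t) powr - (2 * s))) (at t)"
  using particles_deriv[of 1 t] particles_deriv[of 2 t] particles_deriv[of 3 t] t
    three_particle_velocity[OF \<zeta>, of "x 2 t - x 1 t" "\<lambda>j. x j t" "x 3 t - x 2 t"]
    particles_gap_pos[of t]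
  by auto

lemma particles_gap_flow:
  "gap_flow (\<gamma> / (2 * s)) (2 * s) T (\<lambda>t. x 2 t - x 1 t) (\<lambda>t. x 3 t - x 2 t)"
proof unfold_locales
  fix t assume t: "0 < t" "ereal t < T"
  show "((\<lambda>t. x 2 t - x 1 t) has_real_derivative
      gap_rate (\<gamma> / (2 * s)) (2 * s) (x 2 t - x 1 t) (x 3 t - x 2 t)) (at t)"
    using DERIV_diff[OF particles_velocity(2,1)[OF t]]
    by (rule back_subst[where P = "\<lambda>d. (_ has_real_derivative d) _"])
      (simp add: gap_rate_def algebra_simps)
  show "((\<lambda>t. x 3 t - x 2 t) has_real_derivative
      gap_rate (\<gamma> / (2 * s)) (2 * s) (x 3 t - x 2 t) (x 2 t - x 1 t)) (at t)"
    using DERIV_diff[OF particles_velocity(3,2)[OF t]]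
    by (rule back_subst[where P = "\<lambda>d. (_ has_real_derivative d) _"])
      (simp add: gap_rate_def algebra_simps)
qed (use \<gamma> s particles_T_pos particles_gap_pos in \<open>auto intro!: continuous_on_diff particles_cont\<close>)

text \<open>The pair forces are antisymmetric, so the velocities sum to 0. Together with the gaps
  this sum determines all positions.\<close>

lemma center_of_mass:
  assumes t: "0 \<le> t" "ereal t < T"
  shows "x 1 t + x 2 t + x 3 t = x0 1 + x0 2 + x0 3"
proof -
  have "x 1 t + x 2 t + x 3 t = x 1 0 + x 2 0 + x 3 0"
  proof (cases "t = 0")
    case False
    show ?thesis
    proof (rule DERIV_isconst_end[of 0 t "\<lambda>t. x 1 t + x 2 t + x 3 t", symmetric, symmetric])
      show "continuous_on {0..t} (\<lambda>t. x 1 t + x 2 t + x 3 t)"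
        using t by (intro continuous_intros particles_cont) auto
      fix z assume z: "0 < z" "z < t"
      then have "ereal z < ereal t" by simp
      then have "ereal z < T" using t(2) by (rule less_trans)
      then show "((\<lambda>t. x 1 t + x 2 t + x 3 t) has_real_derivative 0) (at z)"
        using DERIV_add[OF DERIV_add[OF particles_velocity(1,2)] particles_velocity(3), of z] z
        by (simp add: algebra_simps)
    qed (use t False in simp)
  qed simp
  then show ?thesis unfolding particles_initial .
qed

end

text \<open>\<open>M\<close> is the conserved sum of the positions.\<close>

lemma gap_flow_particle_solution:
  assumes flow: "gap_flow (\<gamma> / (2 * s)) (2 * s) T A B"
    and y: "\<And>t. y 1 t = (M - 2 * A t - B t) / 3" "\<And>t. y 2 t = (M + A t - B t) / 3"
      "\<And>t. y 3 t = (M + A t + 2 * B t) / 3"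
    and x0: "y 1 0 = x0 1" "y 2 0 = x0 2" "y 3 0 = x0 3"
  shows "particle_solution \<gamma> s 3 \<zeta> x0 y T"
proof -
  interpret gap_flow "\<gamma> / (2 * s)" "2 * s" T A B by (rule flow)
  have fun_y: "y 1 = (\<lambda>t. (M - 2 * A t - B t) / 3)" "y 2 = (\<lambda>t. (M + A t - B t) / 3)"
    "y 3 = (\<lambda>t. (M + A t + 2 * B t) / 3)"
    using y by auto
  obtain e where e: "0 < e" "ereal e < T"
    using ereal_dense2[OF T_pos] by auto
  have lim: "(A \<longlongrightarrow> A 0) (at_right 0)" "(B \<longlongrightarrow> B 0) (at_right 0)"
    using cont_on[of 0 e] e
    by (auto simp: continuous_on_eq_continuous_within continuous_within at_within_Icc_at_right
        dest: bspec[of _ _ 0])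
  have "continuous (at_right 0) (y 1)" "continuous (at_right 0) (y 2)" "continuous (at_right 0) (y 3)"
    unfolding fun_y continuous_within by (rule tendsto_intros lim | simp)+
  then have cont: "continuous (at_right 0) (y i)" if "i \<in> {1, 2, 3}" for i
    using that by blast
  have gaps: "0 < A t" "y 2 t - y 1 t = A t" "0 < B t" "y 3 t - y 2 t = B t"
    if "0 < t" "ereal t < T" for t
    using that a_pos[of t] b_pos[of t] unfolding y by (auto simp: field_simps)
  have der: "(y i has_real_derivative particle_velocity \<gamma> s 3 \<zeta> (\<lambda>j. y j t) i) (at t)"
    if t: "0 < t" "ereal t < T" and i: "i \<in> {1, 2, 3}" for t i
  proof -
    note v = three_particle_velocity[OF \<zeta>, of "A t" "\<lambda>j. y j t" "B t" \<gamma> s, OF gaps[OF t]]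
    note r = gap_rate_combinations[of "\<gamma> / (2 * s)" "2 * s" "A t" "B t"]
    have "(y 1 has_real_derivative particle_velocity \<gamma> s 3 \<zeta> (\<lambda>j. y j t) 1) (at t)"
      unfolding v r[symmetric] fun_y
      by (intro DERIV_cdivide DERIV_diff DERIV_const DERIV_cmult deriv_a deriv_b t)
    moreover have "(y 2 has_real_derivative particle_velocity \<gamma> s 3 \<zeta> (\<lambda>j. y j t) 2) (at t)"
      unfolding v r[symmetric] fun_y
      by (intro DERIV_cdivide DERIV_diff DERIV_add DERIV_const deriv_a deriv_b t)
    moreover have "(y 3 has_real_derivative particle_velocity \<gamma> s 3 \<zeta> (\<lambda>j. y j t) 3) (at t)"
      unfolding v r[symmetric] fun_y
      by (intro DERIV_cdivide DERIV_add DERIV_const DERIV_cmult deriv_a deriv_b t)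
    ultimately show ?thesis using i by blast
  qed
  have neq: "y i t \<noteq> y j t"
    if "0 < t" "ereal t < T" "i \<in> {1, 2, 3}" "j \<in> {1, 2, 3}" "i \<noteq> j" for t i j
    using gaps[OF that(1,2)] that(3-5) by auto
  show ?thesis
    unfolding particle_solution_def index_set using T_pos cont der neq x0 by blast
qed

text \<open>Positive limits allow the gaps to be continued past \<open>tc\<close>. Positions rebuilt
  from these gaps and the conserved sum agree with \<open>x\<close> before \<open>tc\<close>, so
  they extend it, against maximality.\<close>

lemma maximal_particle_limits_not_pos:
  assumes max: "maximal_particle_solution \<gamma> s 3 \<zeta> x0 x (ereal tc)"
    and x0: "x0 1 < x0 2" "x0 2 < x0 3"
    and la: "((\<lambda>t. x 2 t - x 1 t) \<longlongrightarrow> al) (at_left tc)"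
    and lb: "((\<lambda>t. x 3 t - x 2 t) \<longlongrightarrow> bl) (at_left tc)"
  shows "\<not> (0 < al \<and> 0 < bl)"
proof
  assume pos: "0 < al \<and> 0 < bl"
  have sol: "particle_solution \<gamma> s 3 \<zeta> x0 x (ereal tc)"
    using max by (simp add: maximal_particle_solution_def)
  have tc: "0 < tc" using particles_T_pos[OF sol x0] by (simp flip: zero_ereal_def)
  define M where "M = x0 1 + x0 2 + x0 3"
  obtain A B T' where T': "ereal tc < T'" and flow: "gap_flow (\<gamma> / (2 * s)) (2 * s) T' A B"
    and AB: "\<And>t. t < tc \<Longrightarrow> A t = x 2 t - x 1 t" "\<And>t. t < tc \<Longrightarrow> B t = x 3 t - x 2 t"
    by (rule gap_flow.continuation[OF particles_gap_flow[OF sol x0] refl la lb])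
      (use pos in auto)
  define y where "y = (\<lambda>i t. if i = 1 then (M - 2 * A t - B t) / 3
    else if i = (2::nat) then (M + A t - B t) / 3 else (M + A t + 2 * B t) / 3)"
  have agree: "y i t = x i t" if "i \<in> {1, 2, 3}" "0 \<le> t" "t < tc" for i t
    using center_of_mass[OF sol x0, of t] AB[of t] that by (auto simp: y_def M_def field_simps)
  have "y 1 0 = x0 1" "y 2 0 = x0 2" "y 3 0 = x0 3"
    using agree[of 1 0] agree[of 2 0] agree[of 3 0] tc particles_initial[OF sol x0] by simp_all
  then have "particle_solution \<gamma> s 3 \<zeta> x0 y T'"
    by (intro gap_flow_particle_solution[OF flow, of y M]) (simp_all add: y_def)
  moreover have "\<forall>i\<in>{1..3}. \<forall>t. 0 \<le> t \<and> ereal t < ereal tc \<longrightarrow> y i t = x i t"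
    unfolding index_set using agree by auto
  ultimately show False
    using max T' unfolding maximal_particle_solution_def by blast
qed

end

text \<open>Since \<open>al <= bl\<close>, a positive \<open>al\<close> would make both limits
  positive, so \<open>al = 0\<close>. Inserting this into the estimates at \<open>T\<close> bounds
  the collision time on both sides.\<close>

lemma (in ordered_gap_flow) smaller_gap_collides:
  assumes no_continuation: "\<And>tc al bl. \<lbrakk>T = ereal tc; (a \<longlongrightarrow> al) (at_left tc); (b \<longlongrightarrow> bl) (at_left tc)\<rbrakk>
    \<Longrightarrow> \<not> (0 < al \<and> 0 < bl)"
  obtains tc bl where "T = ereal tc" "(a \<longlongrightarrow> 0) (at_left tc)" "(b \<longlongrightarrow> bl) (at_left tc)" "0 \<le> bl"
    "a 0 powr (p + 1) / (2 * c * (p + 1)) \<le> tc"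
    "tc \<le> a 0 powr (p + 1) / (c * (1 - 2 powr - p) * (p + 1))"
    "(b 0 - a 0)\<^sup>2 \<le> bl\<^sup>2"
    "a 0 = b 0 \<Longrightarrow> bl = 0 \<and> tc = a 0 powr (p + 1) / (c * (1 - 2 powr - p) * (p + 1))"
proof -
  obtain tc al bl where lim: "T = ereal tc" "0 < tc" "tc \<le> a 0 powr (p + 1) / (\<kappa> * (p + 1))"
    "(a \<longlongrightarrow> al) (at_left tc)" "(b \<longlongrightarrow> bl) (at_left tc)"
    "0 \<le> al" "al \<le> bl" "(b 0 - a 0)\<^sup>2 \<le> (bl - al)\<^sup>2"
    "a 0 powr (p + 1) - 2 * c * (p + 1) * tc \<le> al powr (p + 1)"
    "a 0 = b 0 \<Longrightarrow> al = bl"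
    "a 0 = b 0 \<Longrightarrow> al powr (p + 1) = a 0 powr (p + 1) - \<kappa> * (p + 1) * tc"
    using limits_at_T by metis
  have al: "al = 0" using no_continuation[OF lim(1,4,5)] lim(6,7) by linarith
  have pos: "0 < 2 * c * (p + 1)" "0 < \<kappa> * (p + 1)" using c_pos p_pos \<kappa>_pos by simp_all
  show thesis
  proof
    show "a 0 powr (p + 1) / (2 * c * (p + 1)) \<le> tc"
      using lim(9) pos al by (simp add: pos_divide_le_eq mult.commute)
    show "bl = 0 \<and> tc = a 0 powr (p + 1) / (c * (1 - 2 powr - p) * (p + 1))" if "a 0 = b 0"
    proof
      have "tc * (\<kappa> * (p + 1)) = a 0 powr (p + 1)"
        using lim(11)[OF that] al by (simp add: mult.commute)
      then show "tc = a 0 powr (p + 1) / (c * (1 - 2 powr - p) * (p + 1))"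
        using pos(2) unfolding \<kappa>_def[symmetric] by (intro eq_divide_imp) auto
    qed (use lim(10)[OF that] al in simp)
  qed (use lim al in \<open>auto simp: \<kappa>_def\<close>)
qed

section \<open>Collision constants and the final case distinction\<close>

lemma collision_const_gt_1:
  assumes "0 < s"
  shows "1 < collision_const s"
proof -
  have "1 < (2 :: real) powr (2 * s)" using powr_less_mono[of 0 "2 * s" 2] assms by simp
  then show ?thesis unfolding collision_const_def powr_add by (simp add: pos_less_divide_eq)
qed

text \<open>Translation to \<open>c = \<gamma> / (2 * s)\<close> and \<open>p = 2 * s\<close>. With
  \<open>r = 2 powr (2 * s)\<close>, the second identity rests on
  \<open>2 / (1 - 1 / r) = 2 * r / (r - 1)\<close>.\<close>

lemma collision_time_bounds_eq:
  assumes s: "0 < s" and \<gamma>: "0 < \<gamma>"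
  shows "m / (2 * (\<gamma> / (2 * s)) * (2 * s + 1)) = s * m / ((2 * s + 1) * \<gamma>)"
    and "m / (\<gamma> / (2 * s) * (1 - 2 powr - (2 * s)) * (2 * s + 1)) = collision_const s * (s * m / ((2 * s + 1) * \<gamma>))"
proof -
  show "m / (2 * (\<gamma> / (2 * s)) * (2 * s + 1)) = s * m / ((2 * s + 1) * \<gamma>)"
    using s \<gamma> by (simp add: mult.commute)
  define r where "r = (2 :: real) powr (2 * s)"
  have r: "1 < r" using powr_less_mono[of 0 "2 * s" 2] s by (simp add: r_def)
  have "2 powr - (2 * s) = 1 / r" unfolding r_def by (rule powr_minus_divide)
  then have e1: "1 - 2 powr - (2 * s) = (r - 1) / r" using r by (simp add: field_simps)
  have e2: "collision_const s = 2 * r / (r - 1)"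
    unfolding collision_const_def powr_add r_def by simp
  have "2 * s + 1 \<noteq> 0" "r - 1 \<noteq> 0" using s r by auto
  then show "m / (\<gamma> / (2 * s) * (1 - 2 powr - (2 * s)) * (2 * s + 1))
      = collision_const s * (s * m / ((2 * s + 1) * \<gamma>))"
    unfolding e1 e2 using s \<gamma> r by (simp add: divide_simps)
qed

theorem theorem1p3:
  fixes s \<gamma> \<tau> \<theta>10 \<theta>20 :: real
    and W u :: "real \<Rightarrow> real"
    and \<zeta> x0 :: "nat \<Rightarrow> real"
    and x :: "nat \<Rightarrow> real \<Rightarrow> real"
    and \<theta>1 \<theta>2 :: "real \<Rightarrow> real"
    and Tc :: ereal
  assumes "0 < s" and "s < 1"
    and "multiwell_potential W"
    and "layer_solution s W u"
    and "\<gamma> = layer_gamma u"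
    and "x0 1 < x0 2" and "x0 2 < x0 3"
    and "\<zeta> 1 = 1" and "\<zeta> 2 = -1" and "\<zeta> 3 = 1"
    and "maximal_particle_solution \<gamma> s 3 \<zeta> x0 x Tc"
    and "\<theta>10 = x0 2 - x0 1" and "\<theta>20 = x0 3 - x0 2"
    and "\<theta>1 = (\<lambda>t. x 2 t - x 1 t)" and "\<theta>2 = (\<lambda>t. x 3 t - x 2 t)"
    and "\<tau> = s * (min \<theta>10 \<theta>20) powr (2 * s + 1) / ((2 * s + 1) * \<gamma>)"
  shows "1 < collision_const s \<and>
    (\<exists>tc \<theta>1c \<theta>2c :: real.
       Tc = ereal tc \<and>
       (\<theta>1 \<longlongrightarrow> \<theta>1c) (at_left tc) \<and> (\<theta>2 \<longlongrightarrow> \<theta>2c) (at_left tc) \<and>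
       \<tau> \<le> tc \<and> tc \<le> collision_const s * \<tau> \<and>
       (\<theta>10 < \<theta>20 \<longrightarrow> (\<forall>t\<in>{0..<tc}. \<theta>1 t < \<theta>2 t) \<and> \<theta>1c < \<theta>2c) \<and>
       (\<theta>10 = \<theta>20 \<longrightarrow>
          (\<forall>t\<in>{0..<tc}. \<theta>1 t = \<theta>2 t \<and> 0 < \<theta>2 t) \<and>
          \<theta>1c = 0 \<and> \<theta>2c = 0 \<and>
          tc = collision_const s * s * \<theta>10 powr (2 * s + 1) / ((2 * s + 1) * \<gamma>)) \<and>
       (\<theta>1c = 0 \<and> \<theta>2c = 0 \<longrightarrow>
          \<theta>10 = \<theta>20 \<and>
          tc = collision_const s * s * \<theta>10 powr (2 * s + 1) / ((2 * s + 1) * \<gamma>)))"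
proof -
  have \<gamma>: "0 < \<gamma>" using layer_gamma_pos[of s W u] assms by simp
  note particles = \<gamma> \<open>0 < s\<close> \<open>\<zeta> 1 = 1\<close> \<open>\<zeta> 2 = -1\<close> \<open>\<zeta> 3 = 1\<close>
  have sol: "particle_solution \<gamma> s 3 \<zeta> x0 x Tc"
    using assms by (simp add: maximal_particle_solution_def)
  have flow: "gap_flow (\<gamma> / (2 * s)) (2 * s) Tc \<theta>1 \<theta>2"
    unfolding \<open>\<theta>1 = _\<close> \<open>\<theta>2 = _\<close>
    using particles_gap_flow[OF particles sol] assms by simp
  have init: "\<theta>1 0 = \<theta>10" "\<theta>2 0 = \<theta>20"
    using particles_initial[OF particles sol] assms by simp_all
  have no_continuation: "\<not> (0 < l1 \<and> 0 < l2)"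
    if "Tc = ereal tc" "(\<theta>1 \<longlongrightarrow> l1) (at_left tc)" "(\<theta>2 \<longlongrightarrow> l2) (at_left tc)" for tc l1 l2
    by (rule maximal_particle_limits_not_pos[OF particles, of x0 x tc]) (use that assms in auto)
  note times = collision_time_bounds_eq[OF \<open>0 < s\<close> \<gamma>]
  show ?thesis
  proof (cases "\<theta>10 \<le> \<theta>20")
    case True
    interpret ordered_gap_flow "\<gamma> / (2 * s)" "2 * s" Tc \<theta>1 \<theta>2
      using flow True init by (simp add: ordered_gap_flow_def ordered_gap_flow_axioms_def)
    obtain tc bl where col: "Tc = ereal tc" "(\<theta>1 \<longlongrightarrow> 0) (at_left tc)" "(\<theta>2 \<longlongrightarrow> bl) (at_left tc)"
      "0 \<le> bl" "s * \<theta>10 powr (2 * s + 1) / ((2 * s + 1) * \<gamma>) \<le> tc"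
      "tc \<le> collision_const s * (s * \<theta>10 powr (2 * s + 1) / ((2 * s + 1) * \<gamma>))"
      "(\<theta>20 - \<theta>10)\<^sup>2 \<le> bl\<^sup>2"
      "\<theta>10 = \<theta>20 \<Longrightarrow>
        bl = 0 \<and> tc = collision_const s * (s * \<theta>10 powr (2 * s + 1) / ((2 * s + 1) * \<gamma>))"
      by (rule smaller_gap_collides[unfolded times init]) (use no_continuation in blast)+
    have min: "min \<theta>10 \<theta>20 = \<theta>10" using True by simp
    have less: "\<theta>1 t < \<theta>2 t" if "\<theta>10 < \<theta>20" "t \<in> {0..<tc}" for t
      using strict_order_preserved[of t] that init col(1) by simp
    have eq: "\<theta>1 t = \<theta>2 t \<and> 0 < \<theta>2 t" if "\<theta>10 = \<theta>20" "t \<in> {0..<tc}" for t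
      using equal_gaps_persist[of t] b_pos[of t] that init col(1) by simp
    \<comment> \<open>Unequal gaps keep the squared difference away from 0, so the larger gap
      survives; this is the converse statement on triple collisions.\<close>
    have bl: "0 < bl" if "\<theta>10 < \<theta>20"
      using col(4,7) that by (cases "bl = 0") auto
    show ?thesis
      using True collision_const_gt_1[OF \<open>0 < s\<close>]
      unfolding \<open>\<tau> = _\<close> min
      by (intro conjI exI[of _ tc] exI[of _ 0] exI[of _ bl] impI ballI col(1-6) less bl)
        (use col(8) bl eq in \<open>auto simp: le_less\<close>)
  next
    case False
    \<comment> \<open>With the roles exchanged, the clauses for
      \<open>\<theta>10 < \<theta>20\<close> and for equality are vacuous, and
      \<open>bl \<noteq> 0\<close> excludes a triple collision.\<close>
    interpret ordered_gap_flow "\<gamma> / (2 * s)" "2 * s" Tc \<theta>2 \<theta>1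
      using gap_flow.flip[OF flow] False init by (simp add: ordered_gap_flow_def ordered_gap_flow_axioms_def)
    obtain tc bl where col: "Tc = ereal tc" "(\<theta>2 \<longlongrightarrow> 0) (at_left tc)" "(\<theta>1 \<longlongrightarrow> bl) (at_left tc)"
      "s * \<theta>20 powr (2 * s + 1) / ((2 * s + 1) * \<gamma>) \<le> tc"
      "tc \<le> collision_const s * (s * \<theta>20 powr (2 * s + 1) / ((2 * s + 1) * \<gamma>))"
      "(\<theta>10 - \<theta>20)\<^sup>2 \<le> bl\<^sup>2"
      by (rule smaller_gap_collides[unfolded times init]) (use no_continuation in blast)+
    have min: "min \<theta>10 \<theta>20 = \<theta>20" using False by simp
    have bl: "bl \<noteq> 0" using col(6) False by auto
    show ?thesis
      using collision_const_gt_1[OF \<open>0 < s\<close>]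
      unfolding \<open>\<tau> = _\<close> min
      by (intro conjI exI[of _ tc] exI[of _ bl] exI[of _ 0] impI col(1-5))
        (use bl False in auto)
  qed
qed

end
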